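(* Every cubic symmetric abelian $0$-type bi-Cayley graph is a BCI-graph. That is, let $H$ be a finite abelian group and $S\subseteq H$ be such that $\mathrm{BiCay}(H,S)$ is cubic and symmetric. Then for every subset $T\subseteq H$ with $\mathrm{BiCay}(H,T)\cong \mathrm{BiCay}(H,S)$ there exist $h\in H$ and $\sigma\in \mathrm{Aut}(H)$ such that $T=hS^{\sigma}$.
   Context: All graphs are finite and simple and all groups are finite. A cubic graph is a regular graph of valency $3$. A graph is called symmetric if it is connected and its full automorphism group is transitive on its arcs (ordered pairs of adjacent vertices). For a group $H$ and a subset $S\subseteq H$, the ($0$-type) bi-Cayley graph $\mathrm{BiCay}(H,S)$ has vertex set $H_0\cup H_1$, the disjoint union of two copies $H_0=\{h_0:h\in H\}$, $H_1=\{h_1:h\in H\}$ of $H$, and edge set $\{\{h_0,g_1\}: h,g\in H,\ gh^{-1}\in S\}$. It is called abelian if $H$ is abelian. The bi-Cayley graph $\mathrm{BiCay}(H,S)$ is called a BCI-graph if for every $\mathrm{BiCay}(H,T)$, $T\subseteq H$, $\mathrm{BiCay}(H,T)\cong\mathrm{BiCay}(H,S)$ (as graphs) implies $T=hS^\sigma$ for some $h\in H$ and $\sigma\in\mathrm{Aut}(H)$, where $S^\sigma$ is the image of $S$ under $\sigma$ and $hS^\sigma=\{hx: x\in S^\sigma\}$. *)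

theory Defs
  imports
    "HOL-Algebra.Coset"
    "HOL-Algebra.Bij"
    "Graph_Theory.Graph_Theory"
begin

text \<open>
  As in the Graph_Theory library, a finite simple graph is a digraph satisfying the predicate
  \<open>graph\<close>: finite, without loops or parallel arcs, and with a symmetric arc relation, each edge
  being represented by its two arcs.
\<close>

definition cubic :: "('a, 'b) pre_digraph \<Rightarrow> bool" where
  "cubic G \<longleftrightarrow> (\<forall>v \<in> verts G. out_degree G v = 3)"

definition automorphisms ::
  "('a, 'b) pre_digraph \<Rightarrow> ('a, 'b, 'a, 'b) digraph_isomorphism set" where
  "automorphisms G = {f. pre_digraph.digraph_isomorphism G f \<and> app_iso f G = G}"

definition arc_transitive :: "('a, 'b) pre_digraph \<Rightarrow> bool" where
  "arc_transitive G \<longleftrightarrow>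
    (\<forall>(u, v) \<in> arcs_ends G. \<forall>(x, y) \<in> arcs_ends G.
      \<exists>f \<in> automorphisms G. iso_verts f u = x \<and> iso_verts f v = y)"

text \<open>
  Not to be confused with the library constant \<open>symmetric\<close>, which only says that the arc relation
  is symmetric.
\<close>

definition symmetric_graph :: "('a, 'b) pre_digraph \<Rightarrow> bool" where
  "symmetric_graph G \<longleftrightarrow> connected G \<and> arc_transitive G"

text \<open>The copies $H_0$ and $H_1$ are the images of the carrier under \<open>Inl\<close> and \<open>Inr\<close>.\<close>

definition BiCay :: "('a, 'c) monoid_scheme \<Rightarrow> 'a set \<Rightarrow> ('a + 'a) pair_pre_digraph" where
  "BiCay H S =
    \<lparr> pverts = carrier H <+> carrier H,
      parcs =
        {(Inl h, Inr g) | h g. h \<in> carrier H \<and> g \<in> carrier H \<and> g \<otimes>\<^bsub>H\<^esub> inv\<^bsub>H\<^esub> h \<in> S} \<union>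
        {(Inr g, Inl h) | h g. h \<in> carrier H \<and> g \<in> carrier H \<and> g \<otimes>\<^bsub>H\<^esub> inv\<^bsub>H\<^esub> h \<in> S} \<rparr>"

definition BCI_graph :: "('a, 'c) monoid_scheme \<Rightarrow> 'a set \<Rightarrow> bool" where
  "BCI_graph H S \<longleftrightarrow>
    (\<forall>T \<subseteq> carrier H. digraph_iso (with_proj (BiCay H T)) (with_proj (BiCay H S)) \<longrightarrow>
      (\<exists>h \<in> carrier H. \<exists>\<sigma> \<in> auto H. T = h <#\<^bsub>H\<^esub> (\<sigma> ` S)))"

lemma pair_graph_BiCay:
  assumes "finite (carrier H)"
  shows "pair_graph (BiCay H S)"
proof -
  have wf: "parcs (BiCay H S) \<subseteq> pverts (BiCay H S) \<times> pverts (BiCay H S)"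
    by (auto simp: BiCay_def)
  have fin: "finite (pverts (BiCay H S))"
    using assms by (simp add: BiCay_def)
  show ?thesis
  proof
    show "finite (parcs (BiCay H S))"
      using wf fin by (meson finite_SigmaI finite_subset)
    show "symmetric (with_proj (BiCay H S))"
      by (auto simp: symmetric_def sym_def BiCay_def)
  qed (use wf fin in \<open>auto simp: BiCay_def\<close>)
qed

lemma graph_BiCay:
  assumes "finite (carrier H)"
  shows "graph (with_proj (BiCay H S))"
  using pair_graph_BiCay[OF assms] by (rule pair_graph.pair_graphD_graph)

lemma digraph_iso_BiCay_iff:
  "digraph_iso (with_proj (BiCay H S)) (with_proj (BiCay H T)) \<longleftrightarrow>
    (\<exists>f. bij_betw f (pverts (BiCay H S)) (pverts (BiCay H T)) \<and>
      map_prod f f ` parcs (BiCay H S) = parcs (BiCay H T))"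
  (is "?L \<longleftrightarrow> ?R")
proof
  assume ?L
  then obtain f where
    f: "pre_digraph.digraph_isomorphism (with_proj (BiCay H S)) f"
    and eq: "with_proj (BiCay H T) = app_iso f (with_proj (BiCay H S))"
    by (auto simp: digraph_iso_def)
  have ends: "iso_tail f = fst" "iso_head f = snd"
    using arg_cong[OF eq, of tail] arg_cong[OF eq, of head] by simp_all
  have "iso_arcs f a = map_prod (iso_verts f) (iso_verts f) a" if "a \<in> parcs (BiCay H S)" for a
    using f that ends by (auto simp: pre_digraph.digraph_isomorphism_def prod_eq_iff)
  then have "map_prod (iso_verts f) (iso_verts f) ` parcs (BiCay H S) = parcs (BiCay H T)"
    using arg_cong[OF eq, of arcs] by (simp cong: image_cong)
  moreover have "bij_betw (iso_verts f) (pverts (BiCay H S)) (pverts (BiCay H T))"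
    using f arg_cong[OF eq, of verts] by (simp add: pre_digraph.digraph_isomorphism_def bij_betw_def)
  ultimately show ?R by blast
next
  assume ?R
  then obtain f where
    f: "bij_betw f (pverts (BiCay H S)) (pverts (BiCay H T))"
    and eq: "map_prod f f ` parcs (BiCay H S) = parcs (BiCay H T)"
    by blast
  let ?f = "\<lparr>iso_verts = f, iso_arcs = map_prod f f, iso_head = snd, iso_tail = fst\<rparr>"
  have wf: "parcs (BiCay H S) \<subseteq> pverts (BiCay H S) \<times> pverts (BiCay H S)"
    by (auto simp: BiCay_def)
  have "inj_on (map_prod f f) (parcs (BiCay H S))"
    by (rule inj_on_subset[OF map_prod_inj_on wf]) (use f in \<open>auto simp: bij_betw_def\<close>)
  moreover have "wf_digraph (with_proj (BiCay H S))"
    using wf by unfold_locales auto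
  ultimately have "pre_digraph.digraph_isomorphism (with_proj (BiCay H S)) ?f"
    using f by (auto simp: pre_digraph.digraph_isomorphism_def bij_betw_def)
  moreover have "with_proj (BiCay H T) = app_iso ?f (with_proj (BiCay H S))"
    using f eq by (simp add: with_proj_def app_iso_def bij_betw_def)
  ultimately show ?L
    by (auto simp: digraph_iso_def)
qed

end

theory Submission
  imports Defs
begin

text \<open>
  A closed walk of length six in $\mathrm{BiCay}(H,S)$ without backtracking is read off its edge
  labels as a word $x_1 y_1 x_2 y_2 x_3 y_3$ over $S$ with $x_1x_2x_3 = y_1y_2y_3$ and cyclically
  consecutive letters distinct; since $H$ is abelian, the words $i\,k\,j\,i\,k\,j$ always occur, and
  $\mathrm{BiCay}(H,S)$ is a quotient of the hexagonal lattice with these hexagons as faces.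

  If no other words occur for $S$ or for $T$, then an isomorphism maps faces to faces. Opposite
  edges of a face carry the same label, so the induced map of labels is the same at all vertices,
  which makes the isomorphism affine.

  If other words occur for both, then arc-transitivity, which makes all pairs of edges at a vertex
  equivalent, forces a relation for each pair of elements of $S$. Either two elements of $S$ have the
  same square and $|H| \leq 4$, or $p^3 = q^2 r$ for a labelling $S = \{p,q,r\}$ and $S$ is a
  translate of $\{1, a, a^{-2}\}$ with $a$ a generator of $H$, or all elements of $S$ have the same
  cube and $H$ is elementary abelian of order $9$. In each case the relations determine $S$ up to an
  affine map.
\<close>

text \<open>Labels and faces are not graph invariants, so an automorphism need not preserve them.
  What it does preserve is whether two edges at a vertex lie on two common hexagons, or on a square.
  At a vertex of valency three an unordered pair of edges is named by the remaining edge, so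
  transitivity on arcs spreads such a property from one pair to all three, and each pair yields a
  relation of its own. Two labels with equal squares also account for extra words; there it is the
  square itself that is spread, and the squares on all three pairs bound the order of the group.

  Genericity enters on one side only: hexagons mapped into a graph without other words must land on
  faces, so it is enough that \<open>S\<close> or \<open>T\<close> is generic. If neither is, the
  isomorphism merely transfers the hypotheses to \<open>T\<close>, the two sets are classified
  separately, and the types are told apart by the group: equal cubes force exponent 3, and there p^3
  = q^2 r would give q = r.\<close>

section \<open>Isomorphisms as vertex maps\<close>

definition bicay_iso ::
  "('a, 'c) monoid_scheme \<Rightarrow> 'a set \<Rightarrow> 'a set \<Rightarrow> ('a + 'a \<Rightarrow> 'a + 'a) \<Rightarrow> bool" where
  "bicay_iso H S T f \<longleftrightarrow>
    bij_betw f (pverts (BiCay H S)) (pverts (BiCay H T)) \<and>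
    map_prod f f ` parcs (BiCay H S) = parcs (BiCay H T)"

text \<open>Arc-transitivity in terms of vertex maps, so that automorphisms compose with
  isomorphisms between graphs of different sets.\<close>

definition arc_homogeneous :: "('a, 'c) monoid_scheme \<Rightarrow> 'a set \<Rightarrow> bool" where
  "arc_homogeneous H S \<longleftrightarrow>
    (\<forall>(u, v) \<in> parcs (BiCay H S). \<forall>(x, y) \<in> parcs (BiCay H S).
      \<exists>f. bicay_iso H S S f \<and> f u = x \<and> f v = y)"

text \<open>Connectedness as an induction principle: it is applied to sets of vertices that are
  visibly closed under adjacency, without handling walks.\<close>

definition adj_connected :: "('a, 'c) monoid_scheme \<Rightarrow> 'a set \<Rightarrow> bool" where
  "adj_connected H S \<longleftrightarrow>
    (\<forall>B \<subseteq> pverts (BiCay H S). B \<noteq> {} \<longrightarrow> parcs (BiCay H S) `` B \<subseteq> B \<longrightarrow> B = pverts (BiCay H S))"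

lemma pverts_BiCay [simp]: "pverts (BiCay H S) = carrier H <+> carrier H"
  by (simp add: BiCay_def)

lemma parcs_BiCay_verts:
  assumes "(u, v) \<in> parcs (BiCay H S)"
  shows "u \<in> carrier H <+> carrier H" "v \<in> carrier H <+> carrier H"
  using assms by (auto simp: BiCay_def)

lemma parcs_BiCay_sym: "(u, v) \<in> parcs (BiCay H S) \<longleftrightarrow> (v, u) \<in> parcs (BiCay H S)"
  by (auto simp: BiCay_def)

lemma parcs_BiCay_simps [simp]:
  "(Inl h, Inr g) \<in> parcs (BiCay H S) \<longleftrightarrow>
    h \<in> carrier H \<and> g \<in> carrier H \<and> g \<otimes>\<^bsub>H\<^esub> inv\<^bsub>H\<^esub> h \<in> S"
  "(Inr g, Inl h) \<in> parcs (BiCay H S) \<longleftrightarrow>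
    h \<in> carrier H \<and> g \<in> carrier H \<and> g \<otimes>\<^bsub>H\<^esub> inv\<^bsub>H\<^esub> h \<in> S"
  "(Inl h, Inl h') \<notin> parcs (BiCay H S)"
  "(Inr g, Inr g') \<notin> parcs (BiCay H S)"
  by (auto simp: BiCay_def)

lemma bicay_iso_bij:
  "bicay_iso H S T f \<Longrightarrow> bij_betw f (carrier H <+> carrier H) (carrier H <+> carrier H)"
  by (simp add: bicay_iso_def)

lemma bicay_iso_arc:
  assumes "bicay_iso H S T f" "u \<in> carrier H <+> carrier H" "v \<in> carrier H <+> carrier H"
  shows "(f u, f v) \<in> parcs (BiCay H T) \<longleftrightarrow> (u, v) \<in> parcs (BiCay H S)"
proof
  assume "(f u, f v) \<in> parcs (BiCay H T)"
  then have "(f u, f v) \<in> map_prod f f ` parcs (BiCay H S)"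
    using assms(1) unfolding bicay_iso_def by blast
  then obtain x y where xy: "(x, y) \<in> parcs (BiCay H S)" "f x = f u" "f y = f v"
    by auto
  have "inj_on f (carrier H <+> carrier H)"
    using bicay_iso_bij[OF assms(1)] by (simp add: bij_betw_def)
  then have "x = u" "y = v"
    using xy(2,3) assms(2,3) parcs_BiCay_verts[OF xy(1)] by (auto dest: inj_onD)
  with xy show "(u, v) \<in> parcs (BiCay H S)" by simp
next
  assume "(u, v) \<in> parcs (BiCay H S)"
  then have "map_prod f f (u, v) \<in> parcs (BiCay H T)"
    using assms(1) unfolding bicay_iso_def by blast
  then show "(f u, f v) \<in> parcs (BiCay H T)" by simp
qed

lemma bicay_iso_arcD:
  "bicay_iso H S T f \<Longrightarrow> (u, v) \<in> parcs (BiCay H S) \<Longrightarrow> (f u, f v) \<in> parcs (BiCay H T)"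
  by (simp add: bicay_iso_arc[OF _ parcs_BiCay_verts])

lemma bicay_iso_eq_iff:
  assumes "bicay_iso H S T f" "u \<in> carrier H <+> carrier H" "v \<in> carrier H <+> carrier H"
  shows "f u = f v \<longleftrightarrow> u = v"
  using bicay_iso_bij[OF assms(1)] assms(2,3) by (auto simp: bij_betw_def dest: inj_onD)

lemma bicay_isoI:
  assumes "bij_betw f (carrier H <+> carrier H) (carrier H <+> carrier H)"
    and "\<And>u v. u \<in> carrier H <+> carrier H \<Longrightarrow> v \<in> carrier H <+> carrier H \<Longrightarrow>
      (f u, f v) \<in> parcs (BiCay H T) \<longleftrightarrow> (u, v) \<in> parcs (BiCay H S)"
  shows "bicay_iso H S T f"
proof -
  have "map_prod f f ` parcs (BiCay H S) \<subseteq> parcs (BiCay H T)"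
  proof
    fix e assume "e \<in> map_prod f f ` parcs (BiCay H S)"
    then obtain u v where "e = (f u, f v)" "(u, v) \<in> parcs (BiCay H S)" by auto
    then show "e \<in> parcs (BiCay H T)"
      using assms(2)[of u v] parcs_BiCay_verts[of u v H S] by simp
  qed
  moreover have "parcs (BiCay H T) \<subseteq> map_prod f f ` parcs (BiCay H S)"
  proof
    fix e assume e: "e \<in> parcs (BiCay H T)"
    obtain x y where xy: "e = (x, y)" by fastforce
    have "x \<in> f ` (carrier H <+> carrier H)" "y \<in> f ` (carrier H <+> carrier H)"
      using e xy parcs_BiCay_verts[of x y H T] assms(1) by (simp_all add: bij_betw_def)
    then obtain u v where "x = f u" "y = f v"
      "u \<in> carrier H <+> carrier H" "v \<in> carrier H <+> carrier H"
      by blast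
    then show "e \<in> map_prod f f ` parcs (BiCay H S)"
      using assms(2)[of u v] e xy by (metis image_eqI map_prod_simp)
  qed
  ultimately show ?thesis using assms(1) by (simp add: bicay_iso_def)
qed

lemma bicay_iso_comp:
  assumes "bicay_iso H S T f" "bicay_iso H T U g"
  shows "bicay_iso H S U (g \<circ> f)"
proof (rule bicay_isoI)
  show "bij_betw (g \<circ> f) (carrier H <+> carrier H) (carrier H <+> carrier H)"
    using assms bij_betw_trans bicay_iso_bij by blast
  fix u v assume uv: "u \<in> carrier H <+> carrier H" "v \<in> carrier H <+> carrier H"
  have "f u \<in> carrier H <+> carrier H" "f v \<in> carrier H <+> carrier H"
    using uv bij_betw_apply[OF bicay_iso_bij[OF assms(1)]] by simp_all
  then show "((g \<circ> f) u, (g \<circ> f) v) \<in> parcs (BiCay H U) \<longleftrightarrow> (u, v) \<in> parcs (BiCay H S)"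
    using bicay_iso_arc[OF assms(1)] bicay_iso_arc[OF assms(2)] uv by simp
qed

lemma bicay_iso_inv:
  assumes "bicay_iso H S T f"
  shows "bicay_iso H T S (inv_into (carrier H <+> carrier H) f)"
    (is "bicay_iso H T S ?g")
proof (rule bicay_isoI)
  have bij: "bij_betw f (carrier H <+> carrier H) (carrier H <+> carrier H)"
    using assms by (rule bicay_iso_bij)
  then show g: "bij_betw ?g (carrier H <+> carrier H) (carrier H <+> carrier H)"
    by (rule bij_betw_inv_into)
  fix u v assume uv: "u \<in> carrier H <+> carrier H" "v \<in> carrier H <+> carrier H"
  have "?g u \<in> carrier H <+> carrier H" "?g v \<in> carrier H <+> carrier H"
    using uv bij_betw_apply[OF g] by simp_all
  moreover have "f (?g u) = u" "f (?g v) = v"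
    using uv bij by (simp_all add: bij_betw_inv_into_right)
  ultimately show "(?g u, ?g v) \<in> parcs (BiCay H S) \<longleftrightarrow> (u, v) \<in> parcs (BiCay H T)"
    using bicay_iso_arc[OF assms, of "?g u" "?g v"] by simp
qed

text \<open>An automorphism leaves \<open>tail\<close> and \<open>head\<close> equal to
  \<open>fst\<close> and \<open>snd\<close>, which forces its arc map to be the vertex map applied
  to both ends.\<close>

lemma automorphism_bicay_iso:
  assumes "f \<in> automorphisms (with_proj (BiCay H S))"
  shows "bicay_iso H S S (iso_verts f)"
proof -
  have f: "pre_digraph.digraph_isomorphism (with_proj (BiCay H S)) f"
    and eq: "app_iso f (with_proj (BiCay H S)) = with_proj (BiCay H S)"
    using assms by (auto simp: automorphisms_def)
  have ends: "iso_tail f = fst" "iso_head f = snd"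
    using arg_cong[OF eq, of tail] arg_cong[OF eq, of head] by simp_all
  have "iso_arcs f a = map_prod (iso_verts f) (iso_verts f) a" if "a \<in> parcs (BiCay H S)" for a
    using f that ends by (auto simp: pre_digraph.digraph_isomorphism_def prod_eq_iff)
  then have "map_prod (iso_verts f) (iso_verts f) ` parcs (BiCay H S) = parcs (BiCay H S)"
    using arg_cong[OF eq, of arcs] by (simp cong: image_cong)
  moreover have "bij_betw (iso_verts f) (pverts (BiCay H S)) (pverts (BiCay H S))"
    using f arg_cong[OF eq, of verts]
    by (simp add: pre_digraph.digraph_isomorphism_def bij_betw_def)
  ultimately show ?thesis by (simp add: bicay_iso_def)
qed

lemma arcs_ends_with_proj [simp]: "arcs_ends (with_proj G) = parcs G"
  by (auto simp: arcs_ends_def arc_to_ends_def)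

lemma arc_transitive_arc_homogeneous:
  assumes "arc_transitive (with_proj (BiCay H S))"
  shows "arc_homogeneous H S"
  unfolding arc_homogeneous_def
proof clarify
  fix u v x y assume "(u, v) \<in> parcs (BiCay H S)" "(x, y) \<in> parcs (BiCay H S)"
  then obtain f where "f \<in> automorphisms (with_proj (BiCay H S))" "iso_verts f u = x" "iso_verts f v = y"
    using assms[unfolded arc_transitive_def arcs_ends_with_proj, THEN bspec, THEN case_prodD,
        THEN bspec, THEN case_prodD] by blast
  then show "\<exists>f. bicay_iso H S S f \<and> f u = x \<and> f v = y"
    using automorphism_bicay_iso by blast
qed

lemma connected_adj_connected:
  assumes "finite (carrier H)" "connected (with_proj (BiCay H S))"
  shows "adj_connected H S"
  unfolding adj_connected_def
proof (intro allI impI)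
  fix B assume B: "B \<subseteq> pverts (BiCay H S)" "B \<noteq> {}" "parcs (BiCay H S) `` B \<subseteq> B"
  interpret pair_graph "BiCay H S" using assms(1) by (rule pair_graph_BiCay)
  have sc: "strongly_connected (with_proj (BiCay H S))"
    using symmetric_connected_imp_strongly_connected assms(2) sym_arcs by blast
  obtain u where u: "u \<in> B" using B by blast
  have "v \<in> B" if "v \<in> pverts (BiCay H S)" for v
  proof -
    have "u \<rightarrow>\<^sup>*\<^bsub>with_proj (BiCay H S)\<^esub> v"
      using sc u that B(1) by (auto simp: strongly_connected_def)
    then show ?thesis
    proof (induction rule: reachable_induct)
      case base show ?case by (rule u)
    next
      case (step x y) then show ?case using B(3) by auto
    qed
  qed
  then show "B = pverts (BiCay H S)" using B(1) by blast
qed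

lemma adj_connected_iso:
  assumes f: "bicay_iso H S T f" and "adj_connected H S"
  shows "adj_connected H T"
  unfolding adj_connected_def
proof (intro allI impI)
  let ?V = "carrier H <+> carrier H"
  fix B assume B: "B \<subseteq> pverts (BiCay H T)" "B \<noteq> {}" "parcs (BiCay H T) `` B \<subseteq> B"
  have fV: "f ` ?V = ?V" using bicay_iso_bij[OF f] by (simp add: bij_betw_def)
  \<comment> \<open>The preimage of a closed set is closed, so connectedness of the source makes it
    the whole vertex set.\<close>
  let ?C = "{v \<in> ?V. f v \<in> B}"
  have "B \<subseteq> f ` ?V" using B(1) fV by simp
  then have "?C \<noteq> {}" using B(2) by blast
  moreover have "parcs (BiCay H S) `` ?C \<subseteq> ?C"
    using B(3) bicay_iso_arcD[OF f] parcs_BiCay_verts by fastforce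
  ultimately have "?C = ?V" using assms(2) unfolding adj_connected_def by simp
  then have "f ` ?V \<subseteq> B" by blast
  then show "B = pverts (BiCay H T)" using fV B(1) by simp
qed

lemma arc_homogeneous_iso:
  assumes f: "bicay_iso H S T f" and "arc_homogeneous H S"
  shows "arc_homogeneous H T"
  unfolding arc_homogeneous_def
proof clarify
  fix u v x y assume a: "(u, v) \<in> parcs (BiCay H T)" "(x, y) \<in> parcs (BiCay H T)"
  let ?g = "inv_into (carrier H <+> carrier H) f"
  have g: "bicay_iso H T S ?g" using f by (rule bicay_iso_inv)
  have fg: "f (?g w) = w" if "w \<in> carrier H <+> carrier H" for w
    using bicay_iso_bij[OF f] that by (simp add: bij_betw_inv_into_right)
  obtain p where p: "bicay_iso H S S p" "p (?g u) = ?g x" "p (?g v) = ?g y"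
    using assms(2) bicay_iso_arcD[OF g a(1)] bicay_iso_arcD[OF g a(2)]
    unfolding arc_homogeneous_def by fast
  have "bicay_iso H T T (f \<circ> (p \<circ> ?g))"
    using bicay_iso_comp[OF bicay_iso_comp[OF g p(1)] f] .
  then show "\<exists>q. bicay_iso H T T q \<and> q u = x \<and> q v = y"
    using p fg parcs_BiCay_verts[OF a(2)] by (intro exI[of _ "f \<circ> (p \<circ> ?g)"]) simp
qed

section \<open>Hexagons and squares through the identity vertex\<close>

lemma Inl_mem_Plus [simp]: "Inl x \<in> A <+> B \<longleftrightarrow> x \<in> A"
  by blast

lemma Inr_mem_Plus [simp]: "Inr x \<in> A <+> B \<longleftrightarrow> x \<in> B"
  by blast

text \<open>$x$, $y$, $z$ complete the path $u$, \<open>Inl \<one>\<close>, $w$ to a hexagon.\<close>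

definition hexcomp where
  "hexcomp H S u w x y z \<longleftrightarrow>
    (u, x) \<in> parcs (BiCay H S) \<and> (x, y) \<in> parcs (BiCay H S) \<and>
    (y, z) \<in> parcs (BiCay H S) \<and> (z, w) \<in> parcs (BiCay H S) \<and>
    x \<noteq> Inl \<one>\<^bsub>H\<^esub> \<and> z \<noteq> Inl \<one>\<^bsub>H\<^esub> \<and> x \<noteq> z \<and> y \<noteq> u \<and> y \<noteq> w"

text \<open>One completion of a pair of edges at \<open>Inl \<one>\<close> is always the face. Which
  one it is depends on labels, but the existence of a second completion is invariant under
  isomorphisms fixing \<open>Inl \<one>\<close>.\<close>

definition two_hexagons where
  "two_hexagons H S u w \<longleftrightarrow>
    (\<exists>x y z x' y' z'. hexcomp H S u w x y z \<and> hexcomp H S u w x' y' z' \<and> (x, y, z) \<noteq> (x', y', z'))"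

definition on_square where
  "on_square H S u w \<longleftrightarrow>
    (\<exists>x. x \<noteq> Inl \<one>\<^bsub>H\<^esub> \<and> (u, x) \<in> parcs (BiCay H S) \<and> (x, w) \<in> parcs (BiCay H S))"

definition hexword where
  "hexword H S x1 y1 x2 y2 x3 y3 \<longleftrightarrow>
    {x1, y1, x2, y2, x3, y3} \<subseteq> S \<and>
    x1 \<noteq> y1 \<and> y1 \<noteq> x2 \<and> x2 \<noteq> y2 \<and> y2 \<noteq> x3 \<and> x3 \<noteq> y3 \<and> y3 \<noteq> x1 \<and>
    x1 \<otimes>\<^bsub>H\<^esub> x2 \<otimes>\<^bsub>H\<^esub> x3 = y1 \<otimes>\<^bsub>H\<^esub> y2 \<otimes>\<^bsub>H\<^esub> y3"

text \<open>The words admitted here trace the faces of the hexagonal lattice.\<close>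

definition generic where
  "generic H S \<longleftrightarrow>
    (\<forall>x1 y1 x2 y2 x3 y3. hexword H S x1 y1 x2 y2 x3 y3 \<longrightarrow> y2 = x1 \<and> x2 = y3 \<and> x3 = y1)"

lemma two_hexagons_commute:
  assumes "two_hexagons H S u w"
  shows "two_hexagons H S w u"
proof -
  have "hexcomp H S w u z y x" if "hexcomp H S u w x y z" for x y z
    using that parcs_BiCay_sym unfolding hexcomp_def by metis
  then show ?thesis using assms unfolding two_hexagons_def by blast
qed

lemma on_square_commute:
  assumes "on_square H S u w"
  shows "on_square H S w u"
  using assms parcs_BiCay_sym unfolding on_square_def by metis

lemma hexcomp_iso:
  assumes "bicay_iso H S T f" "\<one>\<^bsub>H\<^esub> \<in> carrier H" "f (Inl \<one>\<^bsub>H\<^esub>) = Inl \<one>\<^bsub>H\<^esub>"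
    and c: "hexcomp H S u w x y z"
  shows "hexcomp H T (f u) (f w) (f x) (f y) (f z)"
proof -
  have o: "Inl \<one>\<^bsub>H\<^esub> \<in> carrier H <+> carrier H" using assms(2) by simp
  have a: "(u, x) \<in> parcs (BiCay H S)" "(x, y) \<in> parcs (BiCay H S)"
    "(y, z) \<in> parcs (BiCay H S)" "(z, w) \<in> parcs (BiCay H S)"
    using c by (simp_all add: hexcomp_def)
  note v = parcs_BiCay_verts[OF a(1)] parcs_BiCay_verts[OF a(3)] parcs_BiCay_verts[OF a(4)]
  note eq = bicay_iso_eq_iff[OF assms(1)]
  show ?thesis
    using c a[THEN bicay_iso_arcD[OF assms(1)]] eq[OF v(2) o] eq[OF v(4) o] eq[OF v(2) v(4)]
      eq[OF v(3) v(1)] eq[OF v(3) v(6)] assms(3)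
    unfolding hexcomp_def by simp
qed

lemma two_hexagons_iso:
  assumes "bicay_iso H S T f" "\<one>\<^bsub>H\<^esub> \<in> carrier H" "f (Inl \<one>\<^bsub>H\<^esub>) = Inl \<one>\<^bsub>H\<^esub>"
    and "two_hexagons H S u w"
  shows "two_hexagons H T (f u) (f w)"
proof -
  obtain x y z x' y' z' where c: "hexcomp H S u w x y z" "hexcomp H S u w x' y' z'"
    "(x, y, z) \<noteq> (x', y', z')"
    using assms(4) unfolding two_hexagons_def by blast
  have v: "p \<in> carrier H <+> carrier H \<and> q \<in> carrier H <+> carrier H \<and> r \<in> carrier H <+> carrier H"
    if "hexcomp H S u w p q r" for p q r
    using that parcs_BiCay_verts unfolding hexcomp_def by blast
  have "(f x, f y, f z) \<noteq> (f x', f y', f z')"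
    using c(3) v[OF c(1)] v[OF c(2)] bicay_iso_eq_iff[OF assms(1)] by simp
  then show ?thesis
    using hexcomp_iso[OF assms(1-3) c(1)] hexcomp_iso[OF assms(1-3) c(2)]
    unfolding two_hexagons_def by blast
qed

lemma on_square_iso:
  assumes "bicay_iso H S T f" "\<one>\<^bsub>H\<^esub> \<in> carrier H" "f (Inl \<one>\<^bsub>H\<^esub>) = Inl \<one>\<^bsub>H\<^esub>"
    and "on_square H S u w"
  shows "on_square H T (f u) (f w)"
proof -
  obtain x where x: "x \<noteq> Inl \<one>\<^bsub>H\<^esub>" "(u, x) \<in> parcs (BiCay H S)" "(x, w) \<in> parcs (BiCay H S)"
    using assms(4) unfolding on_square_def by blast
  have "f x \<noteq> Inl \<one>\<^bsub>H\<^esub>"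
    using bicay_iso_eq_iff[OF assms(1), of x "Inl \<one>\<^bsub>H\<^esub>"] parcs_BiCay_verts[OF x(2)] x(1) assms(2,3)
    by simp
  then show ?thesis
    using x(2,3)[THEN bicay_iso_arcD[OF assms(1)]] unfolding on_square_def by blast
qed

lemma card_3_third:
  assumes "card S = 3" "i \<in> S" "j \<in> S" "i \<noteq> j"
  obtains k where "S = {i, j, k}" "k \<noteq> i" "k \<noteq> j"
proof -
  have fin: "finite S" using assms(1) by (metis card.infinite zero_neq_numeral)
  have "card (S - {i, j}) = 1"
    using assms fin by (subst card_Diff_subset) auto
  then obtain k where k: "S - {i, j} = {k}" by (meson card_1_singletonE)
  then have "S = {i, j, k}" "k \<noteq> i" "k \<noteq> j" using assms(2,3) by auto
  then show thesis by (rule that)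
qed

text \<open>The BCI condition for a single \<open>T\<close>. As a relation it can be reversed, so
  that either of the two sets may play the role of the generic one.\<close>

definition affine_equiv where
  "affine_equiv H S T \<longleftrightarrow> (\<exists>h \<in> carrier H. \<exists>\<sigma> \<in> auto H. T = h <#\<^bsub>H\<^esub> (\<sigma> ` S))"

context comm_group
begin

section \<open>Arcs, valency, connectedness and pairs of edges in terms of labels\<close>

lemma arc_LR_iff:
  assumes "S \<subseteq> carrier G" "h \<in> carrier G" "g \<in> carrier G"
  shows "g \<otimes> inv h \<in> S \<longleftrightarrow> (\<exists>s\<in>S. g = s \<otimes> h)"
proof
  assume "g \<otimes> inv h \<in> S"
  moreover have "g = (g \<otimes> inv h) \<otimes> h" using assms(2,3) by (simp add: m_assoc)
  ultimately show "\<exists>s\<in>S. g = s \<otimes> h" by blast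
next
  assume "\<exists>s\<in>S. g = s \<otimes> h"
  then show "g \<otimes> inv h \<in> S" using assms by (auto simp: m_assoc subset_iff)
qed

lemma arc_mult:
  "S \<subseteq> carrier G \<Longrightarrow> s \<in> S \<Longrightarrow> h \<in> carrier G \<Longrightarrow>
    (Inl h, Inr (s \<otimes> h)) \<in> parcs (BiCay G S)"
  using arc_LR_iff[of S h "s \<otimes> h"] by auto

lemma arc_LE:
  assumes "S \<subseteq> carrier G" "(Inl h, v) \<in> parcs (BiCay G S)"
  obtains s where "s \<in> S" "v = Inr (s \<otimes> h)" "h \<in> carrier G"
proof (cases v)
  case (Inl a)
  with assms(2) show thesis by simp
next
  case (Inr g)
  with assms(2) have "h \<in> carrier G" "g \<in> carrier G" "g \<otimes> inv h \<in> S" by simp_all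
  then show thesis using arc_LR_iff[OF assms(1), of h g] Inr that by auto
qed

lemma arc_RE:
  assumes "S \<subseteq> carrier G" "(Inr g, v) \<in> parcs (BiCay G S)"
  obtains s h where "s \<in> S" "v = Inl h" "g = s \<otimes> h" "h \<in> carrier G"
proof (cases v)
  case (Inr a)
  with assms(2) show thesis by simp
next
  case (Inl h)
  with assms(2) have "h \<in> carrier G" "g \<in> carrier G" "g \<otimes> inv h \<in> S" by simp_all
  then show thesis using arc_LR_iff[OF assms(1), of h g] Inl that by auto
qed

lemma nbrs_Inl:
  assumes "S \<subseteq> carrier G" "h \<in> carrier G"
  shows "parcs (BiCay G S) `` {Inl h} = (\<lambda>s. Inr (s \<otimes> h)) ` S"
  using assms arc_mult by (auto elim: arc_LE)

lemma card_nbrs: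
  assumes "S \<subseteq> carrier G" "v \<in> carrier G <+> carrier G"
  shows "card (parcs (BiCay G S) `` {v}) = card S"
proof (cases v)
  case (Inl h)
  then have h: "h \<in> carrier G" using assms(2) by auto
  have "inj_on (\<lambda>s. Inr (s \<otimes> h) :: 'a + 'a) S"
    using assms(1) h by (auto intro!: inj_onI simp: subset_iff)
  then show ?thesis
    using nbrs_Inl[OF assms(1) h] Inl by (simp add: card_image)
next
  case (Inr g)
  then have g: "g \<in> carrier G" using assms(2) by auto
  have "parcs (BiCay G S) `` {v} = (\<lambda>s. Inl (inv s \<otimes> g)) ` S"
  proof (intro equalityI subsetI)
    fix w assume "w \<in> parcs (BiCay G S) `` {v}"
    then have "(Inr g, w) \<in> parcs (BiCay G S)" using Inr by simp
    then obtain s h where "s \<in> S" "w = Inl h" "g = s \<otimes> h" "h \<in> carrier G"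
      by (rule arc_RE[OF assms(1)])
    moreover have "s \<in> carrier G" using \<open>s \<in> S\<close> assms(1) by blast
    ultimately have "w = Inl (inv s \<otimes> g)" by (simp add: m_assoc[symmetric])
    then show "w \<in> (\<lambda>s. Inl (inv s \<otimes> g)) ` S" using \<open>s \<in> S\<close> by blast
  next
    fix w :: "'a + 'a" assume "w \<in> (\<lambda>s. Inl (inv s \<otimes> g)) ` S"
    then obtain s where s: "s \<in> S" "w = Inl (inv s \<otimes> g)" by blast
    then have "s \<in> carrier G" using assms(1) by blast
    moreover from this have "g = s \<otimes> (inv s \<otimes> g)" using g by (simp add: m_assoc[symmetric])
    ultimately have "(Inl (inv s \<otimes> g), Inr g) \<in> parcs (BiCay G S)"
      using arc_mult[OF assms(1) s(1), of "inv s \<otimes> g"] g by simp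
    then show "w \<in> parcs (BiCay G S) `` {v}"
      using parcs_BiCay_sym Inr s(2) by fastforce
  qed
  moreover have "inj_on (\<lambda>s. Inl (inv s \<otimes> g) :: 'a + 'a) S"
    using assms(1) g by (auto intro!: inj_onI simp: subset_iff intro: inj_onD[OF inv_inj])
  ultimately show ?thesis by (simp add: card_image)
qed

lemma cubic_card:
  assumes "S \<subseteq> carrier G" "cubic (with_proj (BiCay G S))"
  shows "card S = 3"
proof -
  have "out_arcs (with_proj (BiCay G S)) (Inl \<one>) = Pair (Inl \<one>) ` (parcs (BiCay G S) `` {Inl \<one>})"
    by (auto simp: out_arcs_def)
  then have "out_degree (with_proj (BiCay G S)) (Inl \<one>) = card (parcs (BiCay G S) `` {Inl \<one>})"
    by (simp add: out_degree_def card_image inj_on_def)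
  then show ?thesis
    using assms(2) card_nbrs[OF assms(1), of "Inl \<one>"] by (simp add: cubic_def)
qed

text \<open>Both cardinalities are valencies, by \<open>card_nbrs\<close>, and \<open>f\<close> maps
  the neighbours of \<open>Inl \<one>\<close> onto those of its image.\<close>

lemma card_iso:
  assumes "S \<subseteq> carrier G" "T \<subseteq> carrier G" "bicay_iso G S T f"
  shows "card S = card T"
proof -
  let ?V = "carrier G <+> carrier G"
  have o: "Inl \<one> \<in> ?V" by simp
  have fV: "bij_betw f ?V ?V" using assms(3) by (rule bicay_iso_bij)
  have "f ` (parcs (BiCay G S) `` {Inl \<one>}) = parcs (BiCay G T) `` {f (Inl \<one>)}"
  proof (intro equalityI subsetI)
    fix w assume "w \<in> f ` (parcs (BiCay G S) `` {Inl \<one>})"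
    then show "w \<in> parcs (BiCay G T) `` {f (Inl \<one>)}" using bicay_iso_arcD[OF assms(3)] by auto
  next
    fix w assume w: "w \<in> parcs (BiCay G T) `` {f (Inl \<one>)}"
    then have "w \<in> ?V" using parcs_BiCay_verts(2)[of "f (Inl \<one>)" w G T] by simp
    then have "w \<in> f ` ?V" using fV unfolding bij_betw_def by simp
    then obtain x where x: "x \<in> ?V" "w = f x" by blast
    then have "(Inl \<one>, x) \<in> parcs (BiCay G S)"
      using w bicay_iso_arc[OF assms(3) o, of x] by simp
    then show "w \<in> f ` (parcs (BiCay G S) `` {Inl \<one>})" using x(2) by simp
  qed
  moreover have "parcs (BiCay G S) `` {Inl \<one>} \<subseteq> ?V"
    using parcs_BiCay_verts(2)[of "Inl \<one>" _ G S] by blast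
  then have "inj_on f (parcs (BiCay G S) `` {Inl \<one>})"
    using fV inj_on_subset unfolding bij_betw_def by blast
  ultimately show ?thesis
    using card_nbrs[OF assms(1) o] card_nbrs[OF assms(2) bij_betw_apply[OF fV o]] card_image by metis
qed

text \<open>Two steps from \<open>Inl x\<close> multiply \<open>x\<close> by a quotient of two
  labels. Connectedness thus becomes induction on group elements: start at \<open>\<one>\<close> and
  multiply by quotients of labels.\<close>

lemma closed_carrier:
  assumes "S \<subseteq> carrier G" "adj_connected G S" "A \<subseteq> carrier G" "\<one> \<in> A"
    and cl: "\<And>x s t. x \<in> A \<Longrightarrow> s \<in> S \<Longrightarrow> t \<in> S \<Longrightarrow> s \<otimes> inv t \<otimes> x \<in> A"
  shows "A = carrier G"
proof -
  \<comment> \<open>\<open>A\<close> on the left and all its neighbours on the right. A step back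
    from \<open>s \<otimes> x\<close> along the label \<open>t\<close> leads to
    \<open>s \<otimes> inv t \<otimes> x\<close>, which is in \<open>A\<close> again.\<close>
  let ?B = "Inl ` A \<union> Inr ` {s \<otimes> x |s x. s \<in> S \<and> x \<in> A}"
  have "?B \<subseteq> carrier G <+> carrier G" using assms(1,3) by blast
  moreover have "?B \<noteq> {}" using assms(4) by blast
  moreover have "parcs (BiCay G S) `` ?B \<subseteq> ?B"
  proof
    fix w assume "w \<in> parcs (BiCay G S) `` ?B"
    then obtain v where v: "v \<in> ?B" "(v, w) \<in> parcs (BiCay G S)" by blast
    show "w \<in> ?B"
    proof (cases v)
      case (Inl h)
      then have "h \<in> A" using v(1) by blast
      have "(Inl h, w) \<in> parcs (BiCay G S)" using v(2) Inl by simp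
      then obtain s where "s \<in> S" "w = Inr (s \<otimes> h)" by (rule arc_LE[OF assms(1)])
      then show ?thesis using \<open>h \<in> A\<close> by blast
    next
      case (Inr g)
      then obtain s x where s: "s \<in> S" "x \<in> A" "g = s \<otimes> x" using v(1) by blast
      have "(Inr g, w) \<in> parcs (BiCay G S)" using v(2) Inr by simp
      then obtain t h where t: "t \<in> S" "w = Inl h" "g = t \<otimes> h" "h \<in> carrier G"
        by (rule arc_RE[OF assms(1)])
      have c: "s \<in> carrier G" "t \<in> carrier G" "x \<in> carrier G" using s t assms(1,3) by auto
      have "s \<otimes> inv t \<otimes> x = inv t \<otimes> (s \<otimes> x)" using c by (simp add: m_ac)
      also have "\<dots> = inv t \<otimes> (t \<otimes> h)" using s(3) t(3) by simp
      also have "\<dots> = h" using c t(4) by (simp add: m_assoc[symmetric])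
      finally show ?thesis using cl[OF s(2,1) t(1)] t(2) by blast
    qed
  qed
  ultimately have B: "?B = carrier G <+> carrier G"
    using assms(2) unfolding adj_connected_def by simp
  have "x \<in> A" if "x \<in> carrier G" for x
  proof -
    have "Inl x \<in> ?B" unfolding B using that by blast
    then show ?thesis by blast
  qed
  then show ?thesis using assms(3) by blast
qed

text \<open>A pair of edges at a vertex of valency three is determined by the remaining edge.\<close>

lemma pair_transitive:
  assumes "S \<subseteq> carrier G" "card S = 3" "arc_homogeneous G S"
    and ij: "i \<in> S" "j \<in> S" "i \<noteq> j" and ij': "i' \<in> S" "j' \<in> S" "i' \<noteq> j'"
  obtains f where "bicay_iso G S S f" "f (Inl \<one>) = Inl \<one>"
    "f (Inr i) = Inr i' \<and> f (Inr j) = Inr j' \<or> f (Inr i) = Inr j' \<and> f (Inr j) = Inr i'"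
proof -
  obtain k where k: "S = {i, j, k}" "k \<noteq> i" "k \<noteq> j" using card_3_third[OF assms(2) ij] .
  obtain k' where k': "S = {i', j', k'}" "k' \<noteq> i'" "k' \<noteq> j'" using card_3_third[OF assms(2) ij'] .
  have arc: "(Inl \<one>, Inr s) \<in> parcs (BiCay G S)" if "s \<in> S" for s
    using arc_mult[OF assms(1) that, of \<one>] that assms(1) by (auto simp: subset_iff)
  have "(Inl \<one>, Inr k) \<in> parcs (BiCay G S)" "(Inl \<one>, Inr k') \<in> parcs (BiCay G S)"
    using k(1) k'(1) arc by auto
  then obtain f where f: "bicay_iso G S S f" "f (Inl \<one>) = Inl \<one>" "f (Inr k) = Inr k'"
    using assms(3) unfolding arc_homogeneous_def by fast
  have im: "\<exists>t\<in>S. f (Inr s) = Inr t" if "s \<in> S" for s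
  proof -
    have "(Inl \<one>, f (Inr s)) \<in> parcs (BiCay G S)"
      using bicay_iso_arcD[OF f(1) arc[OF that]] f(2) by simp
    then obtain t where "t \<in> S" "f (Inr s) = Inr (t \<otimes> \<one>)" by (rule arc_LE[OF assms(1)])
    moreover from this have "t \<in> carrier G" using assms(1) by blast
    ultimately show ?thesis by auto
  qed
  have V: "Inr s \<in> carrier G <+> carrier G" if "s \<in> S" for s using that assms(1) by blast
  obtain p q where pq: "p \<in> S" "q \<in> S" "f (Inr i) = Inr p" "f (Inr j) = Inr q"
    using im ij by blast
  have "k \<in> S" using k(1) by blast
  then have "p \<noteq> k'" "q \<noteq> k'" "p \<noteq> q"
    using bicay_iso_eq_iff[OF f(1) V V, of i k] bicay_iso_eq_iff[OF f(1) V V, of j k]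
      bicay_iso_eq_iff[OF f(1) V V, of i j] pq(3,4) f(3) k(2,3) ij by auto
  then have "p = i' \<and> q = j' \<or> p = j' \<and> q = i'" using pq(1,2) k'(1) by auto
  then show thesis using that f(1,2) pq(3,4) by blast
qed

section \<open>Extra hexagons and the relations behind them\<close>

lemma hexword_cases:
  assumes "{i, j, k} \<subseteq> carrier G" "i \<noteq> j" "k \<noteq> i" "k \<noteq> j"
    and w: "hexword G {i, j, k} i y1 x2 y2 x3 j"
  shows "y2 = i \<and> x2 = j \<and> x3 = y1 \<and> y1 = k \<or>
    i \<otimes> i = j \<otimes> j \<or> i \<otimes> i = k \<otimes> k \<or> j \<otimes> j = k \<otimes> k \<or>
    i \<otimes> i \<otimes> i = j \<otimes> j \<otimes> k \<or> i \<otimes> i \<otimes> i = k \<otimes> k \<otimes> j \<or>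
    j \<otimes> j \<otimes> j = i \<otimes> i \<otimes> k \<or> j \<otimes> j \<otimes> j = k \<otimes> k \<otimes> i \<or>
    i \<otimes> i \<otimes> i = j \<otimes> j \<otimes> j"
proof -
  have c: "i \<in> carrier G" "j \<in> carrier G" "k \<in> carrier G" using assms(1) by auto
  have c1: "b \<otimes> b = d \<otimes> d"
    if "a \<in> carrier G" "b \<in> carrier G" "d \<in> carrier G" "a \<otimes> b \<otimes> b = d \<otimes> d \<otimes> a" for a b d
  proof -
    have "a \<otimes> (b \<otimes> b) = a \<otimes> (d \<otimes> d)" using that by (simp add: m_ac)
    then show ?thesis using that(1-3) by simp
  qed
  have ac: "a \<otimes> b \<otimes> a = a \<otimes> a \<otimes> b" "b \<otimes> a \<otimes> a = a \<otimes> a \<otimes> b"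
    if "a \<in> carrier G" "b \<in> carrier G" for a b
    using that by (simp_all add: m_ac)
  have "y1 \<in> {j, k}" "x3 \<in> {i, k}" "x2 \<in> {i, j, k} - {y1}" "y2 \<in> {i, j, k} - {x2, x3}"
    and eq: "i \<otimes> x2 \<otimes> x3 = y1 \<otimes> y2 \<otimes> j"
    using w unfolding hexword_def by auto
  \<comment> \<open>Distinctness of consecutive letters leaves eleven choices for the four inner
    letters. The tenth is the face; each of the others gives, sometimes after cancelling a common
    letter, one of the listed relations.\<close>
  then consider
      "y1 = j" "x2 = i" "y2 = j" "x3 = i" | "y1 = j" "x2 = i" "y2 = j" "x3 = k"
    | "y1 = j" "x2 = i" "y2 = k" "x3 = i"
    | "y1 = j" "x2 = k" "y2 = i" "x3 = k" | "y1 = j" "x2 = k" "y2 = j" "x3 = i"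
    | "y1 = j" "x2 = k" "y2 = j" "x3 = k"
    | "y1 = k" "x2 = i" "y2 = j" "x3 = i" | "y1 = k" "x2 = i" "y2 = j" "x3 = k"
    | "y1 = k" "x2 = i" "y2 = k" "x3 = i"
    | "y1 = k" "x2 = j" "y2 = i" "x3 = k" | "y1 = k" "x2 = j" "y2 = k" "x3 = i"
    using assms(2-4) by auto
  then show ?thesis
  proof cases
    case 1 then show ?thesis using eq by simp
  next
    case 2 then show ?thesis using eq by simp
  next
    case 3 then show ?thesis using eq ac(1)[OF c(2,3)] by simp
  next
    case 4
    then have "i \<otimes> k \<otimes> k = j \<otimes> j \<otimes> i" using eq ac(1)[OF c(2,1)] by simp
    then show ?thesis using c1[OF c(1,3,2)] by simp
  next
    case 5
    then have "j \<otimes> j \<otimes> j = i \<otimes> i \<otimes> k" using eq ac(1)[OF c(1,3)] by simp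
    then show ?thesis by blast
  next
    case 6
    then have "j \<otimes> j \<otimes> j = k \<otimes> k \<otimes> i" using eq ac(2)[OF c(3,1)] by simp
    then show ?thesis by blast
  next
    case 7
    then have "i \<otimes> i \<otimes> i = j \<otimes> j \<otimes> k" using eq ac(2)[OF c(2,3)] by simp
    then show ?thesis by blast
  next
    case 8
    then have "k \<otimes> i \<otimes> i = j \<otimes> j \<otimes> k" using eq ac(2)[OF c(1,3)] ac(2)[OF c(2,3)] by simp
    then show ?thesis using c1[OF c(3,1,2)] by simp
  next
    case 9 then show ?thesis using eq by simp
  next
    case 10 then show ?thesis by simp
  next
    case 11
    then have "j \<otimes> i \<otimes> i = k \<otimes> k \<otimes> j" using eq ac(1)[OF c(1,2)] ac(2)[OF c(1,2)] by simp
    then show ?thesis using c1[OF c(2,1,3)] by simp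
  qed
qed

text \<open>Multiplying the equations at the three right vertices cancels the left vertices and
  leaves the relation between the labels; absence of backtracking becomes distinctness of
  neighbouring letters. The explicit vertices record that the word determines the
  completion.\<close>

lemma hexcomp_hexword:
  assumes "S \<subseteq> carrier G" "i \<in> S" "j \<in> S" "i \<noteq> j"
    and "hexcomp G S (Inr i) (Inr j) x y z"
  obtains y1 x2 y2 x3 where "hexword G S i y1 x2 y2 x3 j"
    "x = Inl (inv y1 \<otimes> i)" "y = Inr (x2 \<otimes> (inv y1 \<otimes> i))" "z = Inl (inv x3 \<otimes> j)"
proof -
  have h: "(Inr i, x) \<in> parcs (BiCay G S)" "(x, y) \<in> parcs (BiCay G S)"
    "(y, z) \<in> parcs (BiCay G S)" "(Inr j, z) \<in> parcs (BiCay G S)"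
    and ne: "x \<noteq> Inl \<one>" "z \<noteq> Inl \<one>" "x \<noteq> z" "y \<noteq> Inr i" "y \<noteq> Inr j"
    using assms(5) parcs_BiCay_sym unfolding hexcomp_def by blast+
  obtain y1 h1 where 1: "y1 \<in> S" "x = Inl h1" "i = y1 \<otimes> h1" "h1 \<in> carrier G"
    using h(1) by (rule arc_RE[OF assms(1)])
  obtain x2 where 2: "x2 \<in> S" "y = Inr (x2 \<otimes> h1)"
    using h(2) unfolding 1(2) by (rule arc_LE[OF assms(1)])
  obtain y2 h2 where 3: "y2 \<in> S" "z = Inl h2" "x2 \<otimes> h1 = y2 \<otimes> h2" "h2 \<in> carrier G"
    using h(3) unfolding 2(2) by (rule arc_RE[OF assms(1)])
  obtain x3 h2' where 4: "x3 \<in> S" "z = Inl h2'" "j = x3 \<otimes> h2'" "h2' \<in> carrier G"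
    using h(4) by (rule arc_RE[OF assms(1)])
  have h2': "h2' = h2" using 3 4 by simp
  have c: "i \<in> carrier G" "j \<in> carrier G" "y1 \<in> carrier G" "x2 \<in> carrier G" "y2 \<in> carrier G"
    "x3 \<in> carrier G" using assms(1-3) 1 2 3 4 by auto
  have i1: "h1 = inv y1 \<otimes> i" "h2 = inv x3 \<otimes> j"
    unfolding 1(3) 4(3) h2' using c 1(4) 3(4) by (simp_all add: m_assoc[symmetric])
  have "(i \<otimes> x2 \<otimes> x3) \<otimes> (h1 \<otimes> h2) = i \<otimes> (x2 \<otimes> h1) \<otimes> (x3 \<otimes> h2)"
    using c 1(4) 3(4) by (simp add: m_ac)
  also have "\<dots> = (y1 \<otimes> h1) \<otimes> (y2 \<otimes> h2) \<otimes> j" using 1(3) 3(3) 4(3) h2' by simp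
  also have "\<dots> = (y1 \<otimes> y2 \<otimes> j) \<otimes> (h1 \<otimes> h2)" using c 1(4) 3(4) by (simp add: m_ac)
  finally have "i \<otimes> x2 \<otimes> x3 = y1 \<otimes> y2 \<otimes> j" using c 1(4) 3(4) by simp
  moreover have "i \<noteq> y1" using ne(1) 1(2) c i1(1) by auto
  moreover have "j \<noteq> x3" using ne(2) 3(2) c i1(2) by auto
  moreover have "y1 \<noteq> x2" using ne(4) 1(3) 2(2) by auto
  moreover have "y2 \<noteq> x3" using ne(5) 2(2) 3(3) 4(3) h2' by auto
  moreover have "x2 \<noteq> y2" using ne(3) 1(2,4) 3(2-4) c by auto
  ultimately have "hexword G S i y1 x2 y2 x3 j"
    using 1(1) 2(1) 3(1) 4(1) assms(2-4) unfolding hexword_def by auto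
  then show thesis using that 1(2) 2(2) 3(2) i1 by blast
qed

text \<open>The relation between the letters says exactly that the vertex opposite to
  \<open>Inl \<one>\<close> is the same when reached from either side, which is the fact
  \<open>m\<close>.\<close>

lemma hexword_hexcomp:
  assumes "S \<subseteq> carrier G" "hexword G S i y1 x2 y2 x3 j"
  shows "hexcomp G S (Inr i) (Inr j) (Inl (inv y1 \<otimes> i)) (Inr (x2 \<otimes> (inv y1 \<otimes> i))) (Inl (inv x3 \<otimes> j))"
proof -
  have s: "i \<in> S" "j \<in> S" "y1 \<in> S" "x2 \<in> S" "y2 \<in> S" "x3 \<in> S"
    and ne: "i \<noteq> y1" "y1 \<noteq> x2" "x2 \<noteq> y2" "y2 \<noteq> x3" "x3 \<noteq> j"
    and eq: "i \<otimes> x2 \<otimes> x3 = y1 \<otimes> y2 \<otimes> j"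
    using assms(2) unfolding hexword_def by auto
  have c: "i \<in> carrier G" "j \<in> carrier G" "y1 \<in> carrier G" "x2 \<in> carrier G" "y2 \<in> carrier G"
    "x3 \<in> carrier G" using s assms(1) by auto
  define h1 where "h1 = inv y1 \<otimes> i"
  define h2 where "h2 = inv x3 \<otimes> j"
  have h: "h1 \<in> carrier G" "h2 \<in> carrier G" unfolding h1_def h2_def using c by simp_all
  have i: "y1 \<otimes> h1 = i" and j: "x3 \<otimes> h2 = j"
    unfolding h1_def h2_def using c by (simp_all add: m_assoc[symmetric])
  have "(x2 \<otimes> h1) \<otimes> (y1 \<otimes> x3) = (y1 \<otimes> h1) \<otimes> x2 \<otimes> x3" using c h by (simp add: m_ac)
  also have "\<dots> = y1 \<otimes> y2 \<otimes> (x3 \<otimes> h2)" unfolding i j by (rule eq)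
  also have "\<dots> = (y2 \<otimes> h2) \<otimes> (y1 \<otimes> x3)" using c h by (simp add: m_ac)
  finally have m: "x2 \<otimes> h1 = y2 \<otimes> h2" using c h by simp
  have "h1 \<noteq> \<one>" using i ne(1) c by auto
  moreover have "h2 \<noteq> \<one>" using j ne(5) c by auto
  moreover have "h1 \<noteq> h2" using m ne(3) c h by auto
  moreover have "x2 \<otimes> h1 \<noteq> i" using i ne(2) c h by auto
  moreover have "x2 \<otimes> h1 \<noteq> j" using j m ne(4) c h by auto
  moreover have "(Inr i, Inl h1) \<in> parcs (BiCay G S)" "(Inl h2, Inr j) \<in> parcs (BiCay G S)"
    "(Inl h1, Inr (x2 \<otimes> h1)) \<in> parcs (BiCay G S)" "(Inr (x2 \<otimes> h1), Inl h2) \<in> parcs (BiCay G S)"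
    using arc_mult[OF assms(1) s(3) h(1)] arc_mult[OF assms(1) s(6) h(2)]
      arc_mult[OF assms(1) s(4) h(1)] arc_mult[OF assms(1) s(5) h(2)] i j m
      parcs_BiCay_sym by metis+
  ultimately show ?thesis
    unfolding hexcomp_def h1_def[symmetric] h2_def[symmetric] by blast
qed

text \<open>A completion is determined by its word, so two different completions cannot both come
  from the face.\<close>

lemma two_hexagons_hexword:
  assumes "{i, j, k} \<subseteq> carrier G" "i \<noteq> j" "k \<noteq> i" "k \<noteq> j"
    and t: "two_hexagons G {i, j, k} (Inr i) (Inr j)"
  obtains y1 x2 y2 x3 where "hexword G {i, j, k} i y1 x2 y2 x3 j"
    "\<not> (y2 = i \<and> x2 = j \<and> x3 = y1 \<and> y1 = k)"
proof -
  obtain x y z x' y' z' where c: "hexcomp G {i, j, k} (Inr i) (Inr j) x y z"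
    "hexcomp G {i, j, k} (Inr i) (Inr j) x' y' z'" "(x, y, z) \<noteq> (x', y', z')"
    using t unfolding two_hexagons_def by blast
  obtain y1 x2 y2 x3 where w: "hexword G {i, j, k} i y1 x2 y2 x3 j"
    "x = Inl (inv y1 \<otimes> i)" "y = Inr (x2 \<otimes> (inv y1 \<otimes> i))" "z = Inl (inv x3 \<otimes> j)"
    by (rule hexcomp_hexword[OF assms(1) _ _ assms(2) c(1)]) auto
  obtain y1' x2' y2' x3' where w': "hexword G {i, j, k} i y1' x2' y2' x3' j"
    "x' = Inl (inv y1' \<otimes> i)" "y' = Inr (x2' \<otimes> (inv y1' \<otimes> i))" "z' = Inl (inv x3' \<otimes> j)"
    by (rule hexcomp_hexword[OF assms(1) _ _ assms(2) c(2)]) auto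
  show thesis
  proof (cases "y2 = i \<and> x2 = j \<and> x3 = y1 \<and> y1 = k")
    case False then show ?thesis using that w(1) by blast
  next
    case True
    then have "\<not> (y2' = i \<and> x2' = j \<and> x3' = y1' \<and> y1' = k)" using c(3) w w' by auto
    then show ?thesis using that w'(1) by blast
  qed
qed

text \<open>An extra word gives a hexagon through the edges labelled by its first and last letters,
  and the face \<open>w0\<close> through these edges is a second one. The letter \<open>y2\<close>
  does not occur in the description of the completion; if the two completions agreed, the relation
  would recover \<open>y2 = i\<close> and the word would be the face.\<close>

lemma not_generic_two_hexagons:
  assumes "S \<subseteq> carrier G" "card S = 3" "\<not> generic G S"
  obtains i j where "i \<in> S" "j \<in> S" "i \<noteq> j" "two_hexagons G S (Inr i) (Inr j)"
proof -
  obtain i y1 x2 y2 x3 j where w: "hexword G S i y1 x2 y2 x3 j"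
    and nc: "\<not> (y2 = i \<and> x2 = j \<and> x3 = y1)"
    using assms(3) unfolding generic_def by blast
  have s: "i \<in> S" "j \<in> S" "y1 \<in> S" "x2 \<in> S" "y2 \<in> S" "x3 \<in> S" and ij: "i \<noteq> j"
    and eq: "i \<otimes> x2 \<otimes> x3 = y1 \<otimes> y2 \<otimes> j"
    using w unfolding hexword_def by auto
  obtain k where k: "S = {i, j, k}" "k \<noteq> i" "k \<noteq> j" using card_3_third[OF assms(2) s(1,2) ij] .
  have ks: "k \<in> S" using k(1) by blast
  have c: "i \<in> carrier G" "j \<in> carrier G" "y1 \<in> carrier G" "x2 \<in> carrier G" "y2 \<in> carrier G"
    "x3 \<in> carrier G" "k \<in> carrier G" using s ks assms(1) by auto
  have w0: "hexword G S i k j i k j"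
    using s ks ij k(2,3) c unfolding hexword_def by (auto simp: m_ac)
  have "\<not> (Inl (inv y1 \<otimes> i) = Inl (inv k \<otimes> i) \<and>
      Inr (x2 \<otimes> (inv y1 \<otimes> i)) = Inr (j \<otimes> (inv k \<otimes> i)) \<and> Inl (inv x3 \<otimes> j) = Inl (inv k \<otimes> j))"
  proof
    assume a: "Inl (inv y1 \<otimes> i) = Inl (inv k \<otimes> i) \<and>
      Inr (x2 \<otimes> (inv y1 \<otimes> i)) = Inr (j \<otimes> (inv k \<otimes> i)) \<and> Inl (inv x3 \<otimes> j) = Inl (inv k \<otimes> j)"
    have y1: "y1 = k" using a c by (metis sum.inject(1) inv_closed inv_inv right_cancel)
    have x3: "x3 = k" using a c by (metis sum.inject(1) inv_closed inv_inv right_cancel)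
    have x2: "x2 = j" using a c y1 by simp
    have "k \<otimes> j \<otimes> i = k \<otimes> j \<otimes> y2" using eq c unfolding y1 x3 x2 by (simp add: m_ac)
    then have "y2 = i" using c by simp
    then show False using nc y1 x3 x2 by blast
  qed
  then have "two_hexagons G S (Inr i) (Inr j)"
    using hexword_hexcomp[OF assms(1) w] hexword_hexcomp[OF assms(1) w0]
    unfolding two_hexagons_def by blast
  then show thesis using that s(1,2) ij by blast
qed

text \<open>One pair of edges with an extra hexagon is carried to every other pair. The automorphism
  may exchange the two edges, hence the appeal to \<open>two_hexagons_commute\<close>.\<close>

lemma not_generic_two_hexagons_all:
  assumes "S \<subseteq> carrier G" "card S = 3" "arc_homogeneous G S" "\<not> generic G S"
    and "i \<in> S" "j \<in> S" "i \<noteq> j"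
  shows "two_hexagons G S (Inr i) (Inr j)"
proof -
  obtain i' j' where ij': "i' \<in> S" "j' \<in> S" "i' \<noteq> j'" and t: "two_hexagons G S (Inr i') (Inr j')"
    using not_generic_two_hexagons[OF assms(1,2,4)] .
  obtain f where f: "bicay_iso G S S f" "f (Inl \<one>) = Inl \<one>"
    "f (Inr i') = Inr i \<and> f (Inr j') = Inr j \<or> f (Inr i') = Inr j \<and> f (Inr j') = Inr i"
    using pair_transitive[OF assms(1-3) ij' assms(5-7)] .
  have "two_hexagons G S (f (Inr i')) (f (Inr j'))"
    using two_hexagons_iso[OF f(1) one_closed f(2) t] .
  then show ?thesis using f(3) two_hexagons_commute by metis
qed

text \<open>If the second common neighbour is joined to \<open>Inr i\<close> by \<open>p\<close> and
  to \<open>Inr j\<close> by \<open>q\<close>, then \<open>i \<otimes> q = j \<otimes> p\<close>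
  with \<open>p \<noteq> i\<close>, \<open>q \<noteq> j\<close> and \<open>p\<close>,
  \<open>q\<close> not both \<open>k\<close>. Three choices remain.\<close>

lemma on_square_iff:
  assumes "{i, j, k} \<subseteq> carrier G" "i \<noteq> j" "k \<noteq> i" "k \<noteq> j"
    and "on_square G {i, j, k} (Inr i) (Inr j)"
  shows "i \<otimes> i = j \<otimes> j \<or> i \<otimes> k = j \<otimes> j \<or> i \<otimes> i = j \<otimes> k"
proof -
  obtain x where x: "x \<noteq> Inl \<one>" "(Inr i, x) \<in> parcs (BiCay G {i, j, k})"
    "(Inr j, x) \<in> parcs (BiCay G {i, j, k})"
    using assms(5) parcs_BiCay_sym unfolding on_square_def by metis
  obtain p h where 1: "p \<in> {i, j, k}" "x = Inl h" "i = p \<otimes> h" "h \<in> carrier G"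
    using x(2) by (rule arc_RE[OF assms(1)])
  obtain q h' where 2: "q \<in> {i, j, k}" "x = Inl h'" "j = q \<otimes> h'" "h' \<in> carrier G"
    using x(3) by (rule arc_RE[OF assms(1)])
  have h': "h' = h" "h \<noteq> \<one>" using 1 2 x(1) by auto
  have c: "p \<in> carrier G" "q \<in> carrier G" "i \<in> carrier G" "j \<in> carrier G" "k \<in> carrier G"
    using assms(1) 1(1) 2(1) by auto
  have "(i \<otimes> q) \<otimes> h = i \<otimes> (q \<otimes> h)" using c 1(4) by (simp add: m_assoc)
  also have "\<dots> = (p \<otimes> h) \<otimes> j" using 1(3) 2(3) h'(1) by simp
  also have "\<dots> = (j \<otimes> p) \<otimes> h" using c 1(4) by (simp add: m_ac)
  finally have eq: "i \<otimes> q = j \<otimes> p" using c 1(4) by simp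
  have "p \<noteq> i" using 1(3,4) h'(2) c by (metis l_cancel_one')
  moreover have "q \<noteq> j" using 2(3) 1(4) h' c by (metis l_cancel_one')
  moreover have "\<not> (p = k \<and> q = k)" using eq c assms(2) by auto
  ultimately show ?thesis using eq 1(1) 2(1) by auto
qed

lemma square_on_square:
  assumes "S \<subseteq> carrier G" "i \<in> S" "j \<in> S" "i \<noteq> j" "i \<otimes> i = j \<otimes> j"
  shows "on_square G S (Inr i) (Inr j)"
proof -
  have c: "i \<in> carrier G" "j \<in> carrier G" using assms(1-3) by auto
  \<comment> \<open>\<open>Inl h\<close> is the second common neighbour:
    \<open>j \<otimes> h = i\<close> by choice, and \<open>i \<otimes> h = j\<close> by the equality
    of the squares.\<close>
  define h where "h = inv j \<otimes> i"
  have h: "h \<in> carrier G" "j \<otimes> h = i" unfolding h_def using c by (simp_all add: m_assoc[symmetric])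
  have "j \<otimes> (i \<otimes> h) = i \<otimes> (j \<otimes> h)" using c h(1) by (simp add: m_ac)
  then have "j \<otimes> (i \<otimes> h) = j \<otimes> j" using h(2) assms(5) by simp
  then have "i \<otimes> h = j" using h(1) c by simp
  moreover have "h \<noteq> \<one>" using h c assms(4) by auto
  ultimately show ?thesis
    using arc_mult[OF assms(1,2) h(1)] arc_mult[OF assms(1,3) h(1)] h(2) parcs_BiCay_sym
    unfolding on_square_def by (metis sum.inject(1))
qed

section \<open>Affine maps between sets of three elements\<close>

lemma affineI:
  assumes "finite (carrier G)" "S \<subseteq> carrier G" "\<phi> \<in> hom G G" "carrier G \<subseteq> \<phi> ` carrier G"
    and "c \<in> carrier G" "T = (\<lambda>s. c \<otimes> \<phi> s) ` S"
  shows "affine_equiv G S T"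
proof -
  \<comment> \<open>Elements of \<open>auto\<close> are extensional maps, hence the restriction.
    Finiteness turns surjectivity into bijectivity.\<close>
  let ?\<sigma> = "restrict \<phi> (carrier G)"
  have im: "\<phi> ` carrier G = carrier G" using assms(3,4) by (auto simp: hom_def)
  then have "inj_on \<phi> (carrier G)" using assms(1) by (simp add: eq_card_imp_inj_on)
  then have "bij_betw ?\<sigma> (carrier G) (carrier G)" using im by (simp add: bij_betw_def)
  moreover have "?\<sigma> \<in> hom G G" using assms(3) by (auto simp: hom_def Pi_iff)
  ultimately have "?\<sigma> \<in> auto G" by (simp add: auto_def Bij_def)
  moreover have "T = c <# (?\<sigma> ` S)"
    using assms(2,6) by (auto simp: l_coset_def)
  ultimately show ?thesis using assms(5) unfolding affine_equiv_def by blast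
qed

lemma affine_sym:
  assumes "S \<subseteq> carrier G" "finite (carrier G)" "affine_equiv G S T"
  shows "affine_equiv G T S"
proof -
  obtain h \<sigma> where h: "h \<in> carrier G" and \<sigma>: "\<sigma> \<in> auto G" and T: "T = h <# (\<sigma> ` S)"
    using assms(3) unfolding affine_equiv_def by blast
  have hom: "\<sigma> \<in> hom G G" and bij: "bij_betw \<sigma> (carrier G) (carrier G)"
    and B: "\<sigma> \<in> Bij (carrier G)" using \<sigma> by (auto simp: auto_def Bij_def)
  have c: "\<sigma> x \<in> carrier G" if "x \<in> carrier G" for x using hom that by (auto simp: hom_def)
  let ?\<tau> = "restrict (inv_into (carrier G) \<sigma>) (carrier G)"
  have \<tau>: "?\<tau> \<in> hom G G" using restrict_inv_into_hom[OF hom B] .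
  have inv: "?\<tau> (\<sigma> x) = x" if "x \<in> carrier G" for x
    using that c bij by (simp add: bij_betw_inv_into_left)
  have h': "?\<tau> h \<in> carrier G" using \<tau> h unfolding hom_def by blast
  have "T \<subseteq> carrier G" using T h c assms(1) by (auto simp: l_coset_def)
  moreover have "carrier G \<subseteq> ?\<tau> ` carrier G"
    using inv c by (metis image_eqI subsetI)
  moreover have "S = (\<lambda>t. inv (?\<tau> h) \<otimes> ?\<tau> t) ` T"
  proof -
    have "inv (?\<tau> h) \<otimes> ?\<tau> (h \<otimes> \<sigma> s) = s" if "s \<in> S" for s
    proof -
      have s: "s \<in> carrier G" using that assms(1) by blast
      have "?\<tau> (h \<otimes> \<sigma> s) = ?\<tau> h \<otimes> s" using hom_mult[OF \<tau> h c[OF s]] inv[OF s] by simp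
      then show ?thesis using h' s by (simp add: m_assoc[symmetric])
    qed
    then have "(\<lambda>s. inv (?\<tau> h) \<otimes> ?\<tau> (h \<otimes> \<sigma> s)) ` S = S" by simp
    moreover have "T = (\<lambda>s. h \<otimes> \<sigma> s) ` S" unfolding T by (auto simp: l_coset_def)
    ultimately show ?thesis by (simp add: image_image)
  qed
  ultimately show ?thesis using h' by (intro affineI[OF assms(2) _ \<tau>]) simp_all
qed

text \<open>Translating by \<open>inv p\<close> makes the first element trivial, so only the two
  ratios to \<open>p\<close> have to be matched by the homomorphism; the translation by
  \<open>p' \<otimes> inv (\<phi> p)\<close> does the rest.\<close>

lemma affine_ratioI:
  assumes "finite (carrier G)" "{p, q, r} \<subseteq> carrier G" "{p', q', r'} \<subseteq> carrier G"
    and \<phi>: "\<phi> \<in> hom G G" and sur: "carrier G \<subseteq> \<phi> ` carrier G"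
    and a: "\<phi> (q \<otimes> inv p) = q' \<otimes> inv p'" and b: "\<phi> (r \<otimes> inv p) = r' \<otimes> inv p'"
  shows "affine_equiv G {p, q, r} {p', q', r'}"
proof -
  have c: "p \<in> carrier G" "q \<in> carrier G" "r \<in> carrier G" "p' \<in> carrier G" "q' \<in> carrier G" "r' \<in> carrier G"
    using assms(2,3) by auto
  have \<phi>c: "\<phi> x \<in> carrier G" if "x \<in> carrier G" for x using \<phi> that by (auto simp: hom_def)
  have *: "p' \<otimes> inv (\<phi> p) \<otimes> \<phi> x = x'"
    if "x \<in> carrier G" "x' \<in> carrier G" "\<phi> (x \<otimes> inv p) = x' \<otimes> inv p'" for x x'
  proof -
    have "\<phi> x = \<phi> ((x \<otimes> inv p) \<otimes> p)" using that(1) c by (simp add: m_assoc)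
    also have "\<dots> = (x' \<otimes> inv p') \<otimes> \<phi> p"
      using hom_mult[OF \<phi>, of "x \<otimes> inv p" p] that c by simp
    finally have "\<phi> x = (x' \<otimes> inv p') \<otimes> \<phi> p" .
    then have "p' \<otimes> inv (\<phi> p) \<otimes> \<phi> x = x' \<otimes> (p' \<otimes> inv p') \<otimes> (\<phi> p \<otimes> inv (\<phi> p))"
      using that(2) c \<phi>c[OF c(1)] by (simp only: m_ac m_closed inv_closed)
    then show ?thesis using that(2) c \<phi>c[OF c(1)] by simp
  qed
  have "p' \<otimes> inv (\<phi> p) \<otimes> \<phi> p = p'" using c \<phi>c[OF c(1)] by (simp add: m_assoc)
  then have "{p', q', r'} = (\<lambda>s. (p' \<otimes> inv (\<phi> p)) \<otimes> \<phi> s) ` {p, q, r}"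
    using *[OF c(2) c(5) a] *[OF c(3) c(6) b] by simp
  then show ?thesis
    using c \<phi>c[OF c(1)] by (intro affineI[OF assms(1,2) \<phi> sur]) simp_all
qed

text \<open>Here three elements are the whole group or the complement of a point, so a translation
  suffices, with the identity as automorphism.\<close>

lemma affine_small:
  assumes "finite (carrier G)" "card (carrier G) \<le> 4" "S \<subseteq> carrier G" "T \<subseteq> carrier G"
    and "card S = 3" "card T = 3"
  shows "affine_equiv G S T"
proof -
  have id: "(\<lambda>x. x) \<in> hom G G" by (simp add: hom_def)
  have "\<exists>c\<in>carrier G. T = (\<lambda>s. c \<otimes> s) ` S"
  proof (cases "card (carrier G) = 3")
    case True
    then have "S = carrier G" "T = carrier G"
      using assms card_subset_eq by metis+
    then show ?thesis by (auto intro!: bexI[of _ \<one>])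
  next
    case False
    moreover have "3 \<le> card (carrier G)" using card_mono[OF assms(1,3)] assms(5) by simp
    ultimately have 4: "card (carrier G) = 4" using assms(2) by simp
    have "card (carrier G - S) = 1" "card (carrier G - T) = 1"
      using 4 assms finite_subset[OF assms(3,1)] finite_subset[OF assms(4,1)]
      by (simp_all add: card_Diff_subset)
    then obtain p q where "carrier G - S = {p}" "carrier G - T = {q}"
      by (meson card_1_singletonE)
    then have pq: "S = carrier G - {p}" "T = carrier G - {q}" "p \<in> carrier G" "q \<in> carrier G"
      using assms(3,4) by auto
    let ?c = "q \<otimes> inv p"
    have inj: "inj_on (\<lambda>s. ?c \<otimes> s) (carrier G)" using pq(3,4) by (auto intro!: inj_onI)
    have "?c \<otimes> p = q" using pq(3,4) by (simp add: m_assoc)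
    moreover have "(\<lambda>s. ?c \<otimes> s) ` carrier G = carrier G"
      using inj pq(3,4) by (intro endo_inj_surj assms(1)) auto
    ultimately have "(\<lambda>s. ?c \<otimes> s) ` S = T"
      unfolding pq(1,2) using inj_on_image_set_diff[OF inj, of "carrier G" "{p}"] pq(3) by simp
    then show ?thesis using pq(3,4) by blast
  qed
  then obtain c where "c \<in> carrier G" "T = (\<lambda>s. c \<otimes> s) ` S" by blast
  then show ?thesis by (intro affineI[OF assms(1,3) id]) simp_all
qed

section \<open>Generation by two ratios\<close>

lemma word2_mult:
  assumes "a \<in> carrier G" "b \<in> carrier G"
  shows "(a [^] (m::int) \<otimes> b [^] (n::int)) \<otimes> (a [^] (m'::int) \<otimes> b [^] (n'::int)) =
    a [^] (m + m') \<otimes> b [^] (n + n')"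
  using assms by (simp add: int_pow_mult m_ac)

text \<open>Any quotient of labels is a quotient of ratios to \<open>p\<close>, namely (s/p)/(t/p),
  so the words in the two ratios are closed in the sense of \<open>closed_carrier\<close>.\<close>

lemma generated_by_ratios:
  assumes "{p, q, r} \<subseteq> carrier G" "adj_connected G {p, q, r}" "x \<in> carrier G"
  obtains m n :: int where "x = (q \<otimes> inv p) [^] m \<otimes> (r \<otimes> inv p) [^] n"
proof -
  let ?a = "q \<otimes> inv p" and ?b = "r \<otimes> inv p"
  let ?A = "{?a [^] m \<otimes> ?b [^] n |(m::int) (n::int). True}"
  have c: "p \<in> carrier G" "q \<in> carrier G" "r \<in> carrier G" using assms(1) by auto
  have ab: "?a \<in> carrier G" "?b \<in> carrier G" using c by simp_all
  have "?A = carrier G"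
  proof (rule closed_carrier[OF assms(1,2)])
    show "?A \<subseteq> carrier G" using ab by auto
    have "\<one> = ?a [^] (0::int) \<otimes> ?b [^] (0::int)" by simp
    then show "\<one> \<in> ?A" by blast
    fix x s t assume x: "x \<in> ?A" and st: "s \<in> {p, q, r}" "t \<in> {p, q, r}"
    have *: "\<exists>(m::int) (n::int). s \<otimes> inv p = ?a [^] m \<otimes> ?b [^] n" if "s \<in> {p, q, r}" for s
    proof -
      have "p \<otimes> inv p = ?a [^] (0::int) \<otimes> ?b [^] (0::int)" using c by simp
      moreover have "?a = ?a [^] (1::int) \<otimes> ?b [^] (0::int)" using ab by simp
      moreover have "?b = ?a [^] (0::int) \<otimes> ?b [^] (1::int)" using ab by simp
      ultimately show ?thesis using that by blast
    qed
    obtain m n m' n' k l :: int where w: "s \<otimes> inv p = ?a [^] m \<otimes> ?b [^] n"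
      "t \<otimes> inv p = ?a [^] m' \<otimes> ?b [^] n'" "x = ?a [^] k \<otimes> ?b [^] l"
      using *[OF st(1)] *[OF st(2)] x by blast
    have sc: "s \<in> carrier G" "t \<in> carrier G" "x \<in> carrier G" using st c w(3) ab by auto
    have it: "inv (t \<otimes> inv p) = ?a [^] (- m') \<otimes> ?b [^] (- n')"
      unfolding w(2) using ab by (simp add: inv_mult int_pow_neg)
    have "(s \<otimes> inv p) \<otimes> inv (t \<otimes> inv p) = (s \<otimes> inv p) \<otimes> (inv t \<otimes> p)"
      using sc c by (simp add: inv_mult)
    also have "\<dots> = s \<otimes> inv t \<otimes> (inv p \<otimes> p)"
      using sc c by (simp only: m_ac m_closed inv_closed)
    finally have "s \<otimes> inv t = (s \<otimes> inv p) \<otimes> inv (t \<otimes> inv p)" using sc c by simp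
    also have "\<dots> = ?a [^] (m - m') \<otimes> ?b [^] (n - n')"
      unfolding it w(1) using word2_mult[OF ab] by simp
    finally have "s \<otimes> inv t \<otimes> x = ?a [^] (m - m' + k) \<otimes> ?b [^] (n - n' + l)"
      unfolding w(3) using word2_mult[OF ab] by simp
    then show "s \<otimes> inv t \<otimes> x \<in> ?A" by blast
  qed
  then show thesis using assms(3) that by blast
qed

lemma int_pow_mod:
  assumes "a \<in> carrier G" "a [^] (M::int) = \<one>"
  shows "a [^] (n::int) = a [^] (n mod M)"
proof -
  have "a [^] n = a [^] (M * (n div M) + n mod M)" by simp
  also have "\<dots> = (a [^] M) [^] (n div M) \<otimes> a [^] (n mod M)"
    using assms(1) by (simp only: int_pow_mult int_pow_pow)
  finally show ?thesis using assms by simp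
qed

text \<open>Exponents may be reduced modulo \<open>M\<close> and \<open>N\<close>. Only the upper
  bound matters, so \<open>a\<close> and \<open>b\<close> may satisfy further relations.\<close>

lemma card_two_generated:
  assumes "a \<in> carrier G" "b \<in> carrier G" "a [^] (int M) = \<one>" "b [^] (int N) = \<one>" "0 < M" "0 < N"
    and gen: "\<And>x. x \<in> carrier G \<Longrightarrow> \<exists>(m::int) (n::int). x = a [^] m \<otimes> b [^] n"
  shows "card (carrier G) \<le> M * N"
proof -
  let ?D = "{0..<int M} \<times> {0..<int N}"
  have "carrier G \<subseteq> (\<lambda>(m, n). a [^] m \<otimes> b [^] n) ` ?D"
  proof
    fix x assume "x \<in> carrier G"
    then obtain m n :: int where "x = a [^] m \<otimes> b [^] n" using gen by blast
    then have "x = a [^] (m mod int M) \<otimes> b [^] (n mod int N)"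
      using int_pow_mod[OF assms(1,3)] int_pow_mod[OF assms(2,4)] by metis
    moreover have "(m mod int M, n mod int N) \<in> ?D" using assms(5,6) by simp
    ultimately show "x \<in> (\<lambda>(m, n). a [^] m \<otimes> b [^] n) ` ?D"
      by (intro image_eqI[of _ _ "(m mod int M, n mod int N)"]) simp_all
  qed
  then have "card (carrier G) \<le> card ?D"
    using surj_card_le[of ?D "carrier G"] by simp
  then show ?thesis by simp
qed

section \<open>The generic case: isomorphisms respect faces\<close>

text \<open>
  Here \<open>\<tau> t h\<close> is the label of the image of the edge with label \<open>t\<close> at \<open>Inl h\<close>. The images of the edges of
  the face through \<open>Inl h\<close> with labels \<open>i, k, j, i, k, j\<close> form a word for \<open>S\<close>, in which opposite
  letters agree.
\<close>

lemma generic_type_map_constant: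
  assumes S: "S \<subseteq> carrier G" "generic G S" "card S = 3"
    and T: "T = {i, j, k}" "T \<subseteq> carrier G" "i \<noteq> j" "k \<noteq> i" "k \<noteq> j"
    and f0: "f0 \<in> carrier G \<rightarrow> carrier G" "inj_on f0 (carrier G)"
    and f1: "f1 \<in> carrier G \<rightarrow> carrier G" "inj_on f1 (carrier G)"
    and arc: "\<And>h t. h \<in> carrier G \<Longrightarrow> t \<in> T \<Longrightarrow> \<tau> t h \<in> S \<and> f1 (t \<otimes> h) = \<tau> t h \<otimes> f0 h"
    and h: "h \<in> carrier G" and t: "t \<in> T"
  shows "\<tau> t (i \<otimes> inv k \<otimes> h) = \<tau> t h"
proof -
  have c: "i \<in> carrier G" "j \<in> carrier G" "k \<in> carrier G" using T(1,2) by auto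
  have m: "i \<in> T" "j \<in> T" "k \<in> T" using T(1) by auto
  \<comment> \<open>\<open>Inl h\<close>, \<open>Inl h1\<close>, \<open>Inl h2\<close> are the left
    vertices of the face. Its right vertices are \<open>i \<otimes> h = k \<otimes> h1\<close>,
    \<open>j \<otimes> h = k \<otimes> h2\<close> and
    \<open>j \<otimes> h1 = i \<otimes> h2\<close>.\<close>
  define h1 where "h1 = i \<otimes> inv k \<otimes> h"
  define h2 where "h2 = j \<otimes> inv k \<otimes> h"
  have hc: "h1 \<in> carrier G" "h2 \<in> carrier G" unfolding h1_def h2_def using c h by simp_all
  have k1: "k \<otimes> h1 = (k \<otimes> inv k) \<otimes> (i \<otimes> h)" and k2: "k \<otimes> h2 = (k \<otimes> inv k) \<otimes> (j \<otimes> h)"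
    unfolding h1_def h2_def using c h by (simp_all only: m_ac m_closed inv_closed)
  have e1: "k \<otimes> h1 = i \<otimes> h" and e2: "k \<otimes> h2 = j \<otimes> h"
    unfolding k1 k2 using c h by simp_all
  have e3: "j \<otimes> h1 = i \<otimes> h2" unfolding h1_def h2_def using c h by (simp add: m_ac)
  have \<tau>: "\<tau> s x \<in> S" "\<tau> s x \<in> carrier G" "f1 (s \<otimes> x) = \<tau> s x \<otimes> f0 x" "f0 x \<in> carrier G"
    if "s \<in> T" "x \<in> carrier G" for s x
    using arc[OF that(2,1)] S(1) f0(1) that(2) by auto
  \<comment> \<open>Injectivity of \<open>f1\<close> keeps labels at a left vertex distinct;
    \<open>end_ne\<close> is the counterpart at a right vertex, from injectivity of
    \<open>f0\<close>.\<close>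
  have type_ne: "\<tau> s x \<noteq> \<tau> s' x" if "s \<in> T" "s' \<in> T" "s \<noteq> s'" "x \<in> carrier G" for s s' x
  proof
    assume "\<tau> s x = \<tau> s' x"
    then have "f1 (s \<otimes> x) = f1 (s' \<otimes> x)" using \<tau>(3) that by simp
    moreover have "s \<in> carrier G" "s' \<in> carrier G" using that T(2) by auto
    ultimately have "s \<otimes> x = s' \<otimes> x" using f1(2) that(4) by (simp add: inj_on_eq_iff)
    then show False using that \<open>s \<in> carrier G\<close> \<open>s' \<in> carrier G\<close> by simp
  qed
  have end_ne: "\<tau> s x \<noteq> \<tau> s' y"
    if "s \<in> T" "s' \<in> T" "s \<noteq> s'" "x \<in> carrier G" "y \<in> carrier G" "s \<otimes> x = s' \<otimes> y" for s s' x y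
  proof
    assume a: "\<tau> s x = \<tau> s' y"
    have sc: "s \<in> carrier G" "s' \<in> carrier G" using that T(2) by auto
    have "\<tau> s x \<otimes> f0 x = \<tau> s' y \<otimes> f0 y"
      using \<tau>(3)[OF that(1,4)] \<tau>(3)[OF that(2,5)] that(6) by simp
    then have "f0 x = f0 y" unfolding a using \<tau>(2)[OF that(2,5)] \<tau>(4)[OF that(1,4)] \<tau>(4)[OF that(2,5)] by simp
    then have "x = y" using f0(2) that(4,5) by (simp add: inj_on_eq_iff)
    then show False using that(3,4,6) sc by simp
  qed
  have q1: "\<tau> i h \<otimes> f0 h = \<tau> k h1 \<otimes> f0 h1"
    using \<tau>(3)[OF m(1) h] \<tau>(3)[OF m(3) hc(1)] e1 by simp
  have q2: "\<tau> j h1 \<otimes> f0 h1 = \<tau> i h2 \<otimes> f0 h2"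
    using \<tau>(3)[OF m(2) hc(1)] \<tau>(3)[OF m(1) hc(2)] e3 by simp
  have q3: "\<tau> k h2 \<otimes> f0 h2 = \<tau> j h \<otimes> f0 h"
    using \<tau>(3)[OF m(3) hc(2)] \<tau>(3)[OF m(2) h] e2 by simp
  note cl = \<tau>(2)[OF m(1) h] \<tau>(2)[OF m(2) h] \<tau>(2)[OF m(2) hc(1)] \<tau>(2)[OF m(3) hc(1)]
    \<tau>(2)[OF m(1) hc(2)] \<tau>(2)[OF m(3) hc(2)] \<tau>(4)[OF m(1) h] \<tau>(4)[OF m(1) hc(1)] \<tau>(4)[OF m(1) hc(2)]
  \<comment> \<open>The product of the three equations at the right vertices; \<open>?F\<close>
    collects the images of the left vertices and cancels.\<close>
  let ?F = "f0 h \<otimes> f0 h1 \<otimes> f0 h2"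
  have "(\<tau> i h \<otimes> \<tau> j h1 \<otimes> \<tau> k h2) \<otimes> ?F = (\<tau> i h \<otimes> f0 h) \<otimes> (\<tau> j h1 \<otimes> f0 h1) \<otimes> (\<tau> k h2 \<otimes> f0 h2)"
    using cl by (simp only: m_ac m_closed)
  also have "\<dots> = (\<tau> k h1 \<otimes> f0 h1) \<otimes> (\<tau> i h2 \<otimes> f0 h2) \<otimes> (\<tau> j h \<otimes> f0 h)"
    unfolding q1 q2 q3 ..
  also have "\<dots> = (\<tau> k h1 \<otimes> \<tau> i h2 \<otimes> \<tau> j h) \<otimes> ?F"
    using cl by (simp only: m_ac m_closed)
  finally have eq: "\<tau> i h \<otimes> \<tau> j h1 \<otimes> \<tau> k h2 = \<tau> k h1 \<otimes> \<tau> i h2 \<otimes> \<tau> j h"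
    using cl by simp
  have "hexword G S (\<tau> i h) (\<tau> k h1) (\<tau> j h1) (\<tau> i h2) (\<tau> k h2) (\<tau> j h)"
    unfolding hexword_def
  proof (intro conjI)
    show "\<tau> i h \<noteq> \<tau> k h1" using end_ne[OF m(1,3) T(4)[symmetric] h hc(1)] e1 by simp
    show "\<tau> k h1 \<noteq> \<tau> j h1" using type_ne[OF m(3,2) T(5) hc(1)] .
    show "\<tau> j h1 \<noteq> \<tau> i h2" using end_ne[OF m(2,1) T(3)[symmetric] hc] e3 by simp
    show "\<tau> i h2 \<noteq> \<tau> k h2" using type_ne[OF m(1,3) T(4)[symmetric] hc(2)] .
    show "\<tau> k h2 \<noteq> \<tau> j h" using end_ne[OF m(3,2) T(5) hc(2) h] e2 by simp
    show "\<tau> j h \<noteq> \<tau> i h" using type_ne[OF m(2,1) T(3)[symmetric] h] .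
  qed (use \<tau>(1) m h hc eq in auto)
  \<comment> \<open>The opposite letters \<open>x2\<close> and \<open>y3\<close> of the word are the
    images of the edges labelled \<open>j\<close> at \<open>h1\<close> and at
    \<open>h\<close>.\<close>
  then have j: "\<tau> j h1 = \<tau> j h" using S(2) unfolding generic_def by blast
  have inS: "\<tau> s x \<in> S" if "s \<in> T" "x \<in> carrier G" for s x using \<tau>(1) that by blast
  have ne: "\<tau> i h \<noteq> \<tau> j h" "\<tau> k h \<noteq> \<tau> i h" "\<tau> k h \<noteq> \<tau> j h" "\<tau> i h1 \<noteq> \<tau> j h1" "\<tau> k h1 \<noteq> \<tau> i h1" "\<tau> k h1 \<noteq> \<tau> j h1"
    "\<tau> k h1 \<noteq> \<tau> i h"
    using type_ne m T(3-5) h hc(1) end_ne[OF m(1,3) T(4)[symmetric] h hc(1)] e1 by auto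
  \<comment> \<open>One label is now known to agree at \<open>h\<close> and \<open>h1\<close>. The
    edge \<open>k\<close> at \<open>h1\<close> ends where the edge \<open>i\<close> at
    \<open>h\<close> ends, so its image label differs from \<open>\<tau> i h\<close>; this excludes
    an exchange of the other two labels.\<close>
  obtain r where r: "S = {\<tau> i h, \<tau> j h, r}" "r \<noteq> \<tau> i h" "r \<noteq> \<tau> j h"
    using card_3_third[OF S(3) inS[OF m(1) h] inS[OF m(2) h] ne(1)] .
  have kk: "\<tau> k h = r" "\<tau> k h1 = r"
    using inS[OF m(3) h] inS[OF m(3) hc(1)] ne j unfolding r(1) by auto
  have ii: "\<tau> i h1 = \<tau> i h" using inS[OF m(1) hc(1)] ne j kk unfolding r(1) by auto
  show ?thesis using t j kk ii unfolding T(1) h1_def by auto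
qed

text \<open>With constant image labels \<open>\<rho>\<close>, the map \<open>f0\<close> turns
  multiplication by \<open>s \<otimes> inv t\<close> into multiplication by
  \<open>\<rho> s \<otimes> inv (\<rho> t)\<close>. Since such quotients reach the whole group,
  \<open>f0\<close> is a homomorphism followed by a translation, and it carries the ratios of
  \<open>T\<close> to ratios of \<open>S\<close>.\<close>

lemma generic_affine_core:
  assumes fin: "finite (carrier G)"
    and S: "S \<subseteq> carrier G" "generic G S" "card S = 3"
    and T: "T \<subseteq> carrier G" "card T = 3" "adj_connected G T"
    and f0: "bij_betw f0 (carrier G) (carrier G)"
    and f1: "f1 \<in> carrier G \<rightarrow> carrier G" "inj_on f1 (carrier G)"
    and arc: "\<And>h t. h \<in> carrier G \<Longrightarrow> t \<in> T \<Longrightarrow> \<exists>s\<in>S. f1 (t \<otimes> h) = s \<otimes> f0 h"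
  shows "affine_equiv G T S"
proof -
  define \<tau> where "\<tau> t h = (SOME s. s \<in> S \<and> f1 (t \<otimes> h) = s \<otimes> f0 h)" for t h
  have \<tau>: "\<tau> t h \<in> S \<and> f1 (t \<otimes> h) = \<tau> t h \<otimes> f0 h" if "h \<in> carrier G" "t \<in> T" for t h
    unfolding \<tau>_def by (rule someI_ex) (use arc[OF that] in blast)
  have f0': "f0 \<in> carrier G \<rightarrow> carrier G" "inj_on f0 (carrier G)"
    using f0 by (auto simp: bij_betw_def)
  have f0c: "f0 x \<in> carrier G" if "x \<in> carrier G" for x using f0'(1) that by blast
  have Tc: "t \<in> carrier G" if "t \<in> T" for t using T(1) that by blast
  \<comment> \<open>Any two distinct labels can play the roles of \<open>i\<close> and
    \<open>k\<close>, so every quotient of labels preserves the image labels.\<close>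
  have step: "\<tau> t (s \<otimes> inv s' \<otimes> h) = \<tau> t h"
    if st: "s \<in> T" "s' \<in> T" "t \<in> T" "h \<in> carrier G" for s s' t h
  proof (cases "s = s'")
    case True then show ?thesis using that Tc by simp
  next
    case False
    obtain j where "T = {s, s', j}" "j \<noteq> s" "j \<noteq> s'" using card_3_third[OF T(2) st(1,2) False] .
    then have "T = {s, j, s'}" "s \<noteq> j" "s' \<noteq> s" "s' \<noteq> j" using False by auto
    then show ?thesis
      using generic_type_map_constant[OF S _ T(1) _ _ _ f0' f1 \<tau> st(4,3), of s j s'] T(1) by simp
  qed
  define \<rho> where "\<rho> t = \<tau> t \<one>" for t
  have "{x \<in> carrier G. \<forall>t\<in>T. \<tau> t x = \<rho> t} = carrier G"
    using step Tc by (intro closed_carrier[OF T(1,3)]) (auto simp: \<rho>_def)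
  then have \<tau>\<rho>: "\<tau> t x = \<rho> t" if "t \<in> T" "x \<in> carrier G" for t x using that by blast
  have \<rho>: "\<rho> t \<in> S" "f1 (t \<otimes> x) = \<rho> t \<otimes> f0 x" if "t \<in> T" "x \<in> carrier G" for t x
    using \<tau> \<tau>\<rho> that by metis+
  have \<rho>c: "\<rho> t \<in> carrier G" if "t \<in> T" for t using \<rho>(1)[OF that one_closed] S(1) by blast
  have shift: "f0 (s \<otimes> inv t \<otimes> x) = \<rho> s \<otimes> inv (\<rho> t) \<otimes> f0 x"
    if "s \<in> T" "t \<in> T" "x \<in> carrier G" for s t x
  proof -
    let ?y = "s \<otimes> inv t \<otimes> x"
    have y: "?y \<in> carrier G" using that Tc by simp
    have "t \<otimes> ?y = (t \<otimes> inv t) \<otimes> (s \<otimes> x)"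
      using that Tc by (simp only: m_ac m_closed inv_closed)
    then have "t \<otimes> ?y = s \<otimes> x" using that Tc by simp
    then have e: "\<rho> t \<otimes> f0 ?y = \<rho> s \<otimes> f0 x" using \<rho>(2) that y by metis
    have "f0 ?y = inv (\<rho> t) \<otimes> (\<rho> t \<otimes> f0 ?y)"
      using \<rho>c[OF that(2)] f0c[OF y] by (simp add: m_assoc[symmetric])
    also have "\<dots> = \<rho> s \<otimes> inv (\<rho> t) \<otimes> f0 x"
      unfolding e using \<rho>c that f0c by (simp add: m_ac)
    finally show ?thesis .
  qed
  \<comment> \<open>Additivity of an affine map in a form free of inverses, suited to induction on
    \<open>x\<close> by \<open>closed_carrier\<close>.\<close>
  have mult: "f0 (x \<otimes> y) \<otimes> f0 \<one> = f0 x \<otimes> f0 y" if "x \<in> carrier G" "y \<in> carrier G" for x y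
  proof -
    have "{x \<in> carrier G. \<forall>y\<in>carrier G. f0 (x \<otimes> y) \<otimes> f0 \<one> = f0 x \<otimes> f0 y} = carrier G" (is "?A = _")
    proof (rule closed_carrier[OF T(1,3)])
      show "\<one> \<in> ?A" using f0c by (simp add: m_comm)
      fix x s t assume x: "x \<in> ?A" and st: "s \<in> T" "t \<in> T"
      have "f0 (s \<otimes> inv t \<otimes> x \<otimes> y) \<otimes> f0 \<one> = f0 (s \<otimes> inv t \<otimes> x) \<otimes> f0 y" if y: "y \<in> carrier G" for y
      proof -
        have xc: "x \<in> carrier G" and e: "f0 (x \<otimes> y) \<otimes> f0 \<one> = f0 x \<otimes> f0 y" using x y by auto
        let ?r = "\<rho> s \<otimes> inv (\<rho> t)"
        have r: "?r \<in> carrier G" using st \<rho>c by simp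
        have "f0 (s \<otimes> inv t \<otimes> x \<otimes> y) = f0 (s \<otimes> inv t \<otimes> (x \<otimes> y))"
          using st Tc xc y by (simp add: m_assoc)
        also have "\<dots> = ?r \<otimes> f0 (x \<otimes> y)" using shift[OF st] xc y by simp
        finally have "f0 (s \<otimes> inv t \<otimes> x \<otimes> y) \<otimes> f0 \<one> = ?r \<otimes> (f0 (x \<otimes> y) \<otimes> f0 \<one>)"
          using r f0c xc y by (simp add: m_assoc)
        also have "\<dots> = f0 (s \<otimes> inv t \<otimes> x) \<otimes> f0 y"
          unfolding e shift[OF st xc] using r f0c xc y by (simp add: m_assoc)
        finally show ?thesis .
      qed
      then show "s \<otimes> inv t \<otimes> x \<in> ?A" using x st Tc by simp
    qed blast
    then show ?thesis using that by blast
  qed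
  define \<phi> where "\<phi> x = f0 x \<otimes> inv (f0 \<one>)" for x
  have \<phi>: "\<phi> \<in> hom G G"
  proof (rule homI)
    fix x y assume xy: "x \<in> carrier G" "y \<in> carrier G"
    then show "\<phi> x \<in> carrier G" unfolding \<phi>_def using f0c by simp
    have "\<phi> x \<otimes> \<phi> y = (f0 x \<otimes> f0 y) \<otimes> (inv (f0 \<one>) \<otimes> inv (f0 \<one>))"
      unfolding \<phi>_def using xy f0c by (simp add: m_ac)
    also have "\<dots> = (f0 (x \<otimes> y) \<otimes> f0 \<one>) \<otimes> (inv (f0 \<one>) \<otimes> inv (f0 \<one>))" using mult[OF xy] by simp
    also have "\<dots> = f0 (x \<otimes> y) \<otimes> (f0 \<one> \<otimes> inv (f0 \<one>)) \<otimes> inv (f0 \<one>)"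
      using xy f0c by (simp only: m_assoc m_closed inv_closed one_closed)
    also have "\<dots> = \<phi> (x \<otimes> y)" unfolding \<phi>_def using xy f0c by simp
    finally show "\<phi> (x \<otimes> y) = \<phi> x \<otimes> \<phi> y" by simp
  qed
  have "inj_on \<phi> (carrier G)"
    using f0'(2) f0c unfolding \<phi>_def by (intro inj_onI) (simp add: inj_on_eq_iff)
  then have sur: "carrier G \<subseteq> \<phi> ` carrier G"
    using endo_inj_surj[OF fin, of \<phi>] \<phi> by (auto simp: hom_def)
  obtain p q r where r: "T = {p, q, r}" "r \<noteq> p" "r \<noteq> q" and qp: "q \<noteq> p"
    using T(2) by (auto simp: card_3_iff)
  have p: "p \<in> T" and q: "q \<in> T" "q \<noteq> p" and rT: "r \<in> T" using r(1) qp by auto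
  have inj: "\<rho> s \<noteq> \<rho> t" if "s \<in> T" "t \<in> T" "s \<noteq> t" for s t
  proof
    assume "\<rho> s = \<rho> t"
    then have "f1 (s \<otimes> \<one>) = f1 (t \<otimes> \<one>)" using \<rho>(2)[OF that(1)] \<rho>(2)[OF that(2)] by simp
    then show False using f1(2) that Tc by (simp add: inj_on_eq_iff)
  qed
  have "{\<rho> p, \<rho> q, \<rho> r} \<subseteq> S" using \<rho>(1)[OF _ one_closed] p q(1) rT by auto
  moreover have "card {\<rho> p, \<rho> q, \<rho> r} = 3"
    using inj[OF p q(1)] inj[OF p rT] inj[OF q(1) rT] q(2) r(2,3) by simp
  moreover have "finite S" using S(1) fin finite_subset by blast
  ultimately have Seq: "S = {\<rho> p, \<rho> q, \<rho> r}" using S(3) card_subset_eq by metis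
  have ratio: "\<phi> (s \<otimes> inv p) = \<rho> s \<otimes> inv (\<rho> p)" if "s \<in> T" for s
  proof -
    have "\<phi> (s \<otimes> inv p) = \<rho> s \<otimes> inv (\<rho> p) \<otimes> f0 \<one> \<otimes> inv (f0 \<one>)"
      unfolding \<phi>_def using shift[OF that p one_closed] that p Tc by simp
    then show ?thesis using \<rho>c[OF that] \<rho>c[OF p] f0c[OF one_closed] by (simp add: m_assoc)
  qed
  show ?thesis
    unfolding Seq r(1)
    using affine_ratioI[OF fin _ _ \<phi> sur ratio[OF q(1)] ratio[OF rT]]
      T(1)[unfolded r(1)] S(1)[unfolded Seq] by blast
qed

text \<open>Exchanging the sides and inverting preserves all labels, because
  \<open>g \<otimes> inv h = inv h \<otimes> inv (inv g)\<close> in an abelian group. Composition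
  with this map repairs an isomorphism that exchanges the sides.\<close>

lemma BiCay_swap:
  assumes "S \<subseteq> carrier G"
  shows "bicay_iso G S S (case_sum (\<lambda>h. Inr (inv h)) (\<lambda>h. Inl (inv h)))" (is "bicay_iso G S S ?w")
proof (rule bicay_isoI)
  let ?V = "carrier G <+> carrier G"
  have w: "?w v \<in> ?V \<and> ?w (?w v) = v" if "v \<in> ?V" for v using that by auto
  show "bij_betw ?w ?V ?V" by (rule bij_betw_byWitness[of _ ?w]) (use w in blast)+
  fix u v assume uv: "u \<in> ?V" "v \<in> ?V"
  have e: "inv h \<otimes> inv (inv g) = g \<otimes> inv h" if "h \<in> carrier G" "g \<in> carrier G" for h g
    using that by (simp add: m_comm)
  show "(?w u, ?w v) \<in> parcs (BiCay G S) \<longleftrightarrow> (u, v) \<in> parcs (BiCay G S)"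
    using uv e by (cases u; cases v) (auto simp: m_comm)
qed

text \<open>Every edge joins the two sides in both graphs, so the vertices whose side is kept form a
  set closed under adjacency.\<close>

lemma bicay_iso_sides:
  assumes "bicay_iso G T S f" "adj_connected G T"
  shows "(\<forall>v\<in>carrier G <+> carrier G. isl (f v) = isl v) \<or>
    (\<forall>v\<in>carrier G <+> carrier G. isl (f v) \<noteq> isl v)"
proof -
  let ?V = "carrier G <+> carrier G"
  have arc: "isl u \<noteq> isl v" if "(u, v) \<in> parcs (BiCay G U)" for u v U
    using that by (cases u; cases v) auto
  let ?B = "{v \<in> ?V. isl (f v) = isl v}"
  have cl: "parcs (BiCay G T) `` ?B \<subseteq> ?B"
  proof
    fix w assume "w \<in> parcs (BiCay G T) `` ?B"
    then obtain v where v: "v \<in> ?B" "(v, w) \<in> parcs (BiCay G T)" by blast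
    then show "w \<in> ?B"
      using arc[OF v(2)] arc[OF bicay_iso_arcD[OF assms(1) v(2)]] parcs_BiCay_verts(2)[OF v(2)] by auto
  qed
  show ?thesis
  proof (cases "?B = {}")
    case True
    then show ?thesis by blast
  next
    case False
    have "?B = ?V"
      by (rule assms(2)[unfolded adj_connected_def pverts_BiCay, THEN spec, THEN mp, THEN mp, THEN mp,
            OF _ False cl]) blast
    then show ?thesis by blast
  qed
qed

lemma generic_affine:
  assumes fin: "finite (carrier G)"
    and S: "S \<subseteq> carrier G" "generic G S" "card S = 3"
    and T: "T \<subseteq> carrier G" "card T = 3" "adj_connected G T"
    and f: "bicay_iso G T S f"
  shows "affine_equiv G T S"
proof -
  let ?V = "carrier G <+> carrier G"
  obtain g where g: "bicay_iso G T S g" and side: "\<And>v. v \<in> ?V \<Longrightarrow> isl (g v) = isl v"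
  proof (cases "\<forall>v\<in>?V. isl (f v) = isl v")
    case True then show thesis using that f by blast
  next
    case False
    then have sw: "\<forall>v\<in>?V. isl (f v) \<noteq> isl v" using bicay_iso_sides[OF f T(3)] by blast
    let ?w = "case_sum (\<lambda>h. Inr (inv h)) (\<lambda>h. Inl (inv h)) :: 'a + 'a \<Rightarrow> 'a + 'a"
    have "isl (?w x) \<noteq> isl x" for x by (cases x) auto
    then have "isl ((?w \<circ> f) v) = isl v" if "v \<in> ?V" for v using sw that by (metis comp_apply)
    then show thesis using that bicay_iso_comp[OF f BiCay_swap[OF S(1)]] by blast
  qed
  have gV: "g v \<in> ?V" if "v \<in> ?V" for v using bij_betw_apply[OF bicay_iso_bij[OF g] that] .
  define f0 where "f0 h = projl (g (Inl h))" for h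
  define f1 where "f1 h = projr (g (Inr h))" for h
  have f0: "g (Inl h) = Inl (f0 h)" "f0 h \<in> carrier G" if "h \<in> carrier G" for h
    using side[of "Inl h"] gV[of "Inl h"] that unfolding f0_def by (auto simp: isl_def)
  have f1: "g (Inr h) = Inr (f1 h)" "f1 h \<in> carrier G" if "h \<in> carrier G" for h
    using side[of "Inr h"] gV[of "Inr h"] that unfolding f1_def by (cases "g (Inr h)"; auto)+
  have inj0: "inj_on f0 (carrier G)"
  proof (rule inj_onI)
    fix x y assume "x \<in> carrier G" "y \<in> carrier G" "f0 x = f0 y"
    then show "x = y" using bicay_iso_eq_iff[OF g, of "Inl x" "Inl y"] f0(1) by simp
  qed
  have inj1: "inj_on f1 (carrier G)"
  proof (rule inj_onI)
    fix x y assume "x \<in> carrier G" "y \<in> carrier G" "f1 x = f1 y"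
    then show "x = y" using bicay_iso_eq_iff[OF g, of "Inr x" "Inr y"] f1(1) by simp
  qed
  have "f0 ` carrier G = carrier G" using endo_inj_surj[OF fin _ inj0] f0(2) by blast
  then have bij0: "bij_betw f0 (carrier G) (carrier G)" using inj0 by (simp add: bij_betw_def)
  have arc: "\<exists>s\<in>S. f1 (t \<otimes> h) = s \<otimes> f0 h" if "h \<in> carrier G" "t \<in> T" for h t
  proof -
    have th: "t \<otimes> h \<in> carrier G" using that T(1) by blast
    have "(g (Inl h), g (Inr (t \<otimes> h))) \<in> parcs (BiCay G S)"
      using bicay_iso_arcD[OF g arc_mult[OF T(1) that(2,1)]] .
    then have "(Inl (f0 h), Inr (f1 (t \<otimes> h))) \<in> parcs (BiCay G S)"
      using f0(1)[OF that(1)] f1(1)[OF th] by simp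
    then show ?thesis by (rule arc_LE[OF S(1)]) auto
  qed
  show ?thesis
    using generic_affine_core[OF fin S T bij0 _ inj1 arc] f1(2) by blast
qed

section \<open>Relations forced on non-generic sets\<close>

lemma card_le_4_cyclic:
  assumes "{p, q, r} \<subseteq> carrier G" "adj_connected G {p, q, r}"
    and "p \<otimes> p = q \<otimes> r" "q \<otimes> q = r \<otimes> r \<or> q \<otimes> q = p \<otimes> r"
  shows "card (carrier G) \<le> 4"
proof -
  have c: "p \<in> carrier G" "q \<in> carrier G" "r \<in> carrier G" using assms(1) by auto
  \<comment> \<open>In terms of ratios the first relation says ab = 1, so \<open>a\<close> alone
    generates the group. The second becomes a^2 = b^2 or a^2 = b, whence a^4 = 1 or a^3 = 1.\<close>
  define a where "a = q \<otimes> inv p"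
  define b where "b = r \<otimes> inv p"
  have ab: "a \<in> carrier G" "b \<in> carrier G" unfolding a_def b_def using c by simp_all
  have "a \<otimes> b = (q \<otimes> r) \<otimes> (inv p \<otimes> inv p)"
    unfolding a_def b_def using c by (simp add: m_ac)
  also have "\<dots> = \<one>" unfolding assms(3)[symmetric] using c by (simp add: m_assoc[symmetric] inv_mult_group[symmetric])
  finally have ab1: "a \<otimes> b = \<one>" .
  then have b: "b = inv a" using inv_equality[of b a] ab by (simp add: m_comm)
  have aa: "a \<otimes> a = (q \<otimes> q) \<otimes> (inv p \<otimes> inv p)"
    unfolding a_def using c by (simp add: m_ac)
  have "\<exists>M. 0 < M \<and> M \<le> 4 \<and> a [^] (int M) = \<one>"
    using assms(4)
  proof
    assume "q \<otimes> q = r \<otimes> r"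
    then have "a \<otimes> a = b \<otimes> b" unfolding aa b_def using c by (simp add: m_ac)
    then have "a \<otimes> a \<otimes> (a \<otimes> a) = a \<otimes> a \<otimes> (b \<otimes> b)" by simp
    also have "\<dots> = (a \<otimes> b) \<otimes> (a \<otimes> b)" using ab by (simp only: m_ac m_closed)
    also have "\<dots> = \<one>" unfolding ab1 by simp
    finally have "a [^] (4::nat) = \<one>" using ab by (simp add: numeral_eq_Suc m_assoc)
    then have "a [^] (int 4) = \<one>" by (simp only: int_pow_int)
    then show ?thesis by (intro exI[of _ 4]) simp
  next
    assume "q \<otimes> q = p \<otimes> r"
    then have "a \<otimes> a = (p \<otimes> inv p) \<otimes> (r \<otimes> inv p)" unfolding aa using c by (simp only: m_ac m_closed inv_closed)
    then have "a \<otimes> a = b" using c unfolding b_def by simp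
    then have "a \<otimes> a \<otimes> a = \<one>" using ab1 ab by (simp add: m_comm)
    then have "a [^] (3::nat) = \<one>" using ab by (simp add: numeral_eq_Suc m_assoc)
    then have "a [^] (int 3) = \<one>" by (simp only: int_pow_int)
    then show ?thesis by (intro exI[of _ 3]) simp
  qed
  then obtain M where M: "0 < M" "M \<le> 4" "a [^] (int M) = \<one>" by blast
  \<comment> \<open>\<open>\<one>\<close> fills the place of the second generator, with modulus
    1.\<close>
  have "\<exists>(m::int) (n::int). x = a [^] m \<otimes> \<one> [^] n" if x: "x \<in> carrier G" for x
  proof -
    obtain m n :: int where "x = a [^] m \<otimes> b [^] n"
      using generated_by_ratios[OF assms(1,2) x] unfolding a_def b_def .
    also have "\<dots> = a [^] (m - n) \<otimes> \<one> [^] (0::int)"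
      unfolding b using ab by (simp add: int_pow_inv int_pow_diff)
    finally show ?thesis by blast
  qed
  then have "card (carrier G) \<le> M * 1"
    using M ab by (intro card_two_generated[of a \<one>]) auto
  then show ?thesis using M(2) by simp
qed

text \<open>Equal squares make the square of each ratio trivial, so exponents matter only modulo
  2.\<close>

lemma card_le_4_exponent_2:
  assumes "{p, q, r} \<subseteq> carrier G" "adj_connected G {p, q, r}"
    and "p \<otimes> p = q \<otimes> q" "p \<otimes> p = r \<otimes> r"
  shows "card (carrier G) \<le> 4"
proof -
  have c: "p \<in> carrier G" "q \<in> carrier G" "r \<in> carrier G" using assms(1) by auto
  have *: "(s \<otimes> inv p) [^] (int 2) = \<one>" if "s \<in> carrier G" "p \<otimes> p = s \<otimes> s" for s
  proof -
    have "(s \<otimes> inv p) \<otimes> (s \<otimes> inv p) = (s \<otimes> s) \<otimes> (inv p \<otimes> inv p)"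
      using that(1) c by (simp add: m_ac)
    also have "\<dots> = (p \<otimes> inv p) \<otimes> (p \<otimes> inv p)"
      unfolding that(2)[symmetric] using c by (simp only: m_ac m_closed inv_closed)
    finally have "(s \<otimes> inv p) [^] (2::nat) = \<one>" using that(1) c by (simp add: numeral_eq_Suc)
    then show ?thesis by (simp only: int_pow_int)
  qed
  have "card (carrier G) \<le> 2 * 2"
  proof (rule card_two_generated[of "q \<otimes> inv p" "r \<otimes> inv p"])
    fix x assume "x \<in> carrier G"
    then show "\<exists>(m::int) (n::int). x = (q \<otimes> inv p) [^] m \<otimes> (r \<otimes> inv p) [^] n"
      using generated_by_ratios[OF assms(1,2)] by metis
  qed (use * c assms(3,4) in auto)
  then show ?thesis by simp
qed

text \<open>The square on the pair \<open>p\<close>, \<open>q\<close> is carried to the pairs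
  containing \<open>r\<close>, and each yields a disjunction by \<open>on_square_iff\<close>.
  Combined with the given equality of squares, every choice is, up to renaming, covered by
  \<open>card_le_4_cyclic\<close> or makes all three squares equal.\<close>

lemma card_le_4_of_square:
  assumes S: "S \<subseteq> carrier G" "card S = 3" "arc_homogeneous G S" "adj_connected G S"
    and sq: "p \<in> S" "q \<in> S" "p \<noteq> q" "p \<otimes> p = q \<otimes> q"
  shows "card (carrier G) \<le> 4"
proof -
  have on_sq: "on_square G S (Inr x) (Inr y)" if xy: "x \<in> S" "y \<in> S" "x \<noteq> y" for x y
  proof -
    obtain f where f: "bicay_iso G S S f" "f (Inl \<one>) = Inl \<one>"
      "f (Inr p) = Inr x \<and> f (Inr q) = Inr y \<or> f (Inr p) = Inr y \<and> f (Inr q) = Inr x"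
      using pair_transitive[OF S(1-3) sq(1-3) xy] .
    have "on_square G S (f (Inr p)) (f (Inr q))"
      using on_square_iso[OF f(1) one_closed f(2) square_on_square[OF S(1) sq]] .
    then show ?thesis using f(3) on_square_commute by metis
  qed
  obtain r where r: "S = {p, q, r}" "r \<noteq> p" "r \<noteq> q" using card_3_third[OF S(2) sq(1-3)] .
  have perm: "S = {q, r, p}" "S = {p, r, q}" "S = {q, p, r}" "S = {r, p, q}" "S = {r, q, p}"
    using r(1) by auto
  have c: "p \<in> carrier G" "q \<in> carrier G" "r \<in> carrier G" using S(1) r(1) by auto
  have R2: "q \<otimes> q = r \<otimes> r \<or> q \<otimes> p = r \<otimes> r \<or> q \<otimes> q = r \<otimes> p"
    using on_sq[of q r] S(1) r sq(3) unfolding perm(1) by (intro on_square_iff) auto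
  have R3: "p \<otimes> p = r \<otimes> r \<or> p \<otimes> q = r \<otimes> r \<or> p \<otimes> p = r \<otimes> q"
    using on_sq[of p r] S(1) r sq(3) unfolding perm(2) by (intro on_square_iff) auto
  have s: "{p, q, r} \<subseteq> carrier G" "{q, p, r} \<subseteq> carrier G" "{r, p, q} \<subseteq> carrier G"
    using c by auto
  have a: "adj_connected G {p, q, r}" "adj_connected G {q, p, r}" "adj_connected G {r, p, q}"
    using S(4) r(1) perm by metis+
  have comm: "q \<otimes> p = p \<otimes> q" "r \<otimes> p = p \<otimes> r" "r \<otimes> q = q \<otimes> r" using c by (simp_all add: m_comm)
  consider "p \<otimes> q = r \<otimes> r" | "q \<otimes> q = r \<otimes> r" "p \<otimes> p = r \<otimes> r" | "q \<otimes> q = p \<otimes> r" "p \<otimes> p = r \<otimes> r"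
    | "p \<otimes> p = q \<otimes> r" "q \<otimes> q = r \<otimes> r" | "p \<otimes> p = q \<otimes> r" "q \<otimes> q = p \<otimes> r"
    using R2 R3 unfolding comm by metis
  then show ?thesis
  proof cases
    case 1
    show ?thesis by (rule card_le_4_cyclic[OF s(3) a(3)]) (use 1 sq(4) in simp_all)
  next
    case 2
    show ?thesis by (rule card_le_4_exponent_2[OF s(1) a(1)]) (use 2 in simp_all)
  next
    case 3
    show ?thesis by (rule card_le_4_cyclic[OF s(2) a(2)]) (use 3 in simp_all)
  next
    case 4
    show ?thesis by (rule card_le_4_cyclic[OF s(1) a(1)]) (use 4 in simp_all)
  next
    case 5
    show ?thesis by (rule card_le_4_cyclic[OF s(1) a(1)]) (use 5 in simp_all)
  qed
qed

text \<open>Every pair of labels has a word other than the face. Once equal squares and relations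
  p^3 = q^2 r are excluded, equality of the cubes is the only alternative left in
  \<open>hexword_cases\<close> for that pair.\<close>

lemma not_generic_cases:
  assumes S: "S \<subseteq> carrier G" "card S = 3" "arc_homogeneous G S" "adj_connected G S"
    and ng: "\<not> generic G S"
  obtains (small) "card (carrier G) \<le> 4"
    | (cyclic) p q r where "S = {p, q, r}" "q \<noteq> r" "p \<otimes> p \<otimes> p = q \<otimes> q \<otimes> r"
    | (cubes) "\<And>p q. p \<in> S \<Longrightarrow> q \<in> S \<Longrightarrow> p \<otimes> p \<otimes> p = q \<otimes> q \<otimes> q"
proof (cases "\<exists>p\<in>S. \<exists>q\<in>S. p \<noteq> q \<and> p \<otimes> p = q \<otimes> q")
  case True
  then show thesis using small card_le_4_of_square[OF S] by blast
next
  case nsq: False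
  show thesis
  proof (cases "\<exists>p q r. S = {p, q, r} \<and> q \<noteq> r \<and> p \<otimes> p \<otimes> p = q \<otimes> q \<otimes> r")
    case True
    then show thesis using cyclic by blast
  next
    case nt: False
    have "i \<otimes> i \<otimes> i = j \<otimes> j \<otimes> j" if ij: "i \<in> S" "j \<in> S" for i j
    proof (cases "i = j")
      case False
      obtain k where k: "S = {i, j, k}" "k \<noteq> i" "k \<noteq> j" using card_3_third[OF S(2) ij False] .
      have ks: "k \<in> S" using k(1) by blast
      have Sc: "{i, j, k} \<subseteq> carrier G" using S(1) k(1) by simp
      have "two_hexagons G {i, j, k} (Inr i) (Inr j)"
        using not_generic_two_hexagons_all[OF S(1-3) ng ij False] k(1) by simp
      then obtain y1 x2 y2 x3 where w: "hexword G {i, j, k} i y1 x2 y2 x3 j"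
        "\<not> (y2 = i \<and> x2 = j \<and> x3 = y1 \<and> y1 = k)"
        by (rule two_hexagons_hexword[OF Sc False k(2,3)])
      have "S = {i, k, j}" "S = {j, i, k}" "S = {j, k, i}" using k(1) by auto
      then have "\<not> i \<otimes> i \<otimes> i = j \<otimes> j \<otimes> k" "\<not> i \<otimes> i \<otimes> i = k \<otimes> k \<otimes> j"
        "\<not> j \<otimes> j \<otimes> j = i \<otimes> i \<otimes> k" "\<not> j \<otimes> j \<otimes> j = k \<otimes> k \<otimes> i"
        using nt k False by metis+
      moreover have "\<not> i \<otimes> i = j \<otimes> j" "\<not> i \<otimes> i = k \<otimes> k" "\<not> j \<otimes> j = k \<otimes> k"
        using nsq ij ks False k(2,3) by metis+
      ultimately show ?thesis using hexword_cases[OF Sc False k(2,3) w(1)] w(2) by argo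
    qed simp
    then show thesis by (rule cubes)
  qed
qed

section \<open>The cyclic case\<close>

lemma cyclic_generated:
  assumes "{p, q, r} \<subseteq> carrier G" "adj_connected G {p, q, r}" "p \<otimes> p \<otimes> p = q \<otimes> q \<otimes> r"
  shows "r \<otimes> inv p = (q \<otimes> inv p) [^] (-2::int)"
    and "x \<in> carrier G \<Longrightarrow> \<exists>m::int. x = (q \<otimes> inv p) [^] m"
proof -
  have c: "p \<in> carrier G" "q \<in> carrier G" "r \<in> carrier G" using assms(1) by auto
  define a where "a = q \<otimes> inv p"
  define b where "b = r \<otimes> inv p"
  have ab: "a \<in> carrier G" "b \<in> carrier G" unfolding a_def b_def using c by simp_all
  \<comment> \<open>Dividing p^3 = q^2 r by p^3 gives a^2 b = 1, the origin of the exponent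
    -2.\<close>
  have "(a \<otimes> a) \<otimes> b = (q \<otimes> q \<otimes> r) \<otimes> (inv p \<otimes> inv p \<otimes> inv p)"
    unfolding a_def b_def using c by (simp only: m_ac m_closed inv_closed)
  also have "\<dots> = (p \<otimes> inv p) \<otimes> (p \<otimes> inv p) \<otimes> (p \<otimes> inv p)"
    unfolding assms(3)[symmetric] using c by (simp only: m_ac m_closed inv_closed)
  also have "\<dots> = \<one>" using c by simp
  finally have "(a \<otimes> a) \<otimes> b = \<one>" .
  then have "b = inv (a \<otimes> a)" using inv_equality[of b "a \<otimes> a"] ab by (simp add: m_comm)
  moreover have "a \<otimes> a = a [^] (2::int)"
    using ab int_pow_mult[of a 1 1] by simp
  ultimately have b: "b = a [^] (-2::int)" using ab int_pow_neg[of a 2] by simp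
  then show "r \<otimes> inv p = (q \<otimes> inv p) [^] (-2::int)" unfolding a_def b_def .
  assume x: "x \<in> carrier G"
  obtain m n :: int where "x = a [^] m \<otimes> b [^] n"
    using generated_by_ratios[OF assms(1,2) x] unfolding a_def b_def .
  also have "\<dots> = a [^] (m + - 2 * n)"
    unfolding b using ab by (simp only: int_pow_mult int_pow_pow)
  finally show "\<exists>m::int. x = (q \<otimes> inv p) [^] m" unfolding a_def by blast
qed

text \<open>Both \<open>a\<close> and \<open>a'\<close> generate the group. With
  \<open>a' = a [^] k\<close> the k-th power map is a homomorphism onto it, and it matches the
  second ratios because both are the power -2 of the first.\<close>

lemma affine_cyclic:
  assumes fin: "finite (carrier G)"
    and S: "{p, q, r} \<subseteq> carrier G" "adj_connected G {p, q, r}" "p \<otimes> p \<otimes> p = q \<otimes> q \<otimes> r"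
    and T: "{p', q', r'} \<subseteq> carrier G" "adj_connected G {p', q', r'}" "p' \<otimes> p' \<otimes> p' = q' \<otimes> q' \<otimes> r'"
  shows "affine_equiv G {p, q, r} {p', q', r'}"
proof -
  define a where "a = q \<otimes> inv p"
  define a' where "a' = q' \<otimes> inv p'"
  have ab: "a \<in> carrier G" "a' \<in> carrier G" unfolding a_def a'_def using S(1) T(1) by simp_all
  obtain k :: int where k: "a' = a [^] k" using cyclic_generated(2)[OF S ab(2)] unfolding a_def by blast
  have hom: "(\<lambda>x. x [^] k) \<in> hom G G"
    by (rule homI) (simp_all add: int_pow_distrib)
  have pow: "(a [^] m) [^] k = a' [^] m" for m :: int
    unfolding k using ab by (simp add: int_pow_pow mult.commute)
  have "carrier G \<subseteq> (\<lambda>x. x [^] k) ` carrier G"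
  proof
    fix x assume "x \<in> carrier G"
    then obtain m :: int where "x = a' [^] m" using cyclic_generated(2)[OF T] unfolding a'_def by blast
    then show "x \<in> (\<lambda>x. x [^] k) ` carrier G" using pow[of m] ab by (intro image_eqI[of _ _ "a [^] m"]) simp_all
  qed
  then show ?thesis
  proof (rule affine_ratioI[OF fin S(1) T(1) hom])
    show "(q \<otimes> inv p) [^] k = q' \<otimes> inv p'" using k unfolding a_def a'_def by simp
    show "(r \<otimes> inv p) [^] k = r' \<otimes> inv p'"
      unfolding cyclic_generated(1)[OF S] cyclic_generated(1)[OF T]
      using pow[of "-2"] unfolding a_def a'_def .
  qed
qed

section \<open>The case of equal cubes\<close>

lemma hom_two_generated:
  assumes ab: "a \<in> carrier G" "b \<in> carrier G" "a' \<in> carrier G" "b' \<in> carrier G"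
    and gen: "\<And>x. x \<in> carrier G \<Longrightarrow> \<exists>(m::int) (n::int). x = a [^] m \<otimes> b [^] n"
    and rel: "\<And>(m::int) (n::int). a [^] m \<otimes> b [^] n = \<one> \<Longrightarrow> a' [^] m \<otimes> b' [^] n = \<one>"
  obtains \<phi> where "\<phi> \<in> hom G G" "\<And>(m::int) (n::int). \<phi> (a [^] m \<otimes> b [^] n) = a' [^] m \<otimes> b' [^] n"
proof -
  \<comment> \<open>The chosen exponents are not unique; \<open>rel\<close> makes the value of
    \<open>\<phi>\<close> independent of the choice.\<close>
  obtain M N :: "'a \<Rightarrow> int" where MN: "x = a [^] M x \<otimes> b [^] N x" if "x \<in> carrier G" for x
    using gen by metis
  define \<phi> where "\<phi> x = a' [^] M x \<otimes> b' [^] N x" for x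
  have \<phi>: "\<phi> (a [^] m \<otimes> b [^] n) = a' [^] m \<otimes> b' [^] n" for m n :: int
  proof -
    let ?x = "a [^] m \<otimes> b [^] n"
    have x: "?x \<in> carrier G" using ab by simp
    have "a [^] (m - M ?x) \<otimes> b [^] (n - N ?x) = ?x \<otimes> inv (a [^] M ?x \<otimes> b [^] N ?x)"
      using ab by (simp add: int_pow_diff inv_mult m_ac)
    also have "\<dots> = \<one>" using MN[OF x] x by simp
    finally have "a' [^] (m - M ?x) \<otimes> b' [^] (n - N ?x) = \<one>" by (rule rel)
    then have "\<phi> ?x = (a' [^] (m - M ?x) \<otimes> b' [^] (n - N ?x)) \<otimes> (a' [^] M ?x \<otimes> b' [^] N ?x)"
      unfolding \<phi>_def using ab by simp
    also have "\<dots> = a' [^] m \<otimes> b' [^] n" using word2_mult[OF ab(3,4)] by simp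
    finally show ?thesis .
  qed
  have "\<phi> \<in> hom G G"
  proof (rule homI)
    fix x y assume xy: "x \<in> carrier G" "y \<in> carrier G"
    show "\<phi> x \<in> carrier G" unfolding \<phi>_def using ab by simp
    have "x \<otimes> y = a [^] (M x + M y) \<otimes> b [^] (N x + N y)"
      using MN[OF xy(1)] MN[OF xy(2)] word2_mult[OF ab(1,2)] by metis
    then show "\<phi> (x \<otimes> y) = \<phi> x \<otimes> \<phi> y"
      using \<phi> word2_mult[OF ab(3,4)] unfolding \<phi>_def[of x] \<phi>_def[of y] by simp
  qed
  then show thesis using that \<phi> by blast
qed

text \<open>If 3 does not divide \<open>n\<close>, then n^2 is 1 modulo 3, and the n-th power of the
  relation expresses \<open>b\<close> as a power of \<open>a\<close>. The group would then have at
  most three elements.\<close>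

lemma exponent_3_independent:
  assumes ab: "a \<in> carrier G" "b \<in> carrier G" "a [^] (3::int) = \<one>" "b [^] (3::int) = \<one>"
    and gen: "\<And>x. x \<in> carrier G \<Longrightarrow> \<exists>(m::int) (n::int). x = a [^] m \<otimes> b [^] n"
    and big: "card (carrier G) > 3" and rel: "a [^] (m::int) \<otimes> b [^] (n::int) = \<one>"
  shows "3 dvd n"
proof (rule ccontr)
  assume "\<not> 3 dvd n"
  then have "n mod 3 = 1 \<or> n mod 3 = 2" by presburger
  moreover have "n * n mod 3 = (n mod 3) * (n mod 3) mod 3" by (simp add: mod_mult_eq)
  ultimately have "n * n mod 3 = 1" by auto
  then have "b [^] (n * n) = b" using int_pow_mod[OF ab(2,4), of "n * n"] ab(2) by simp
  moreover have "a [^] (m * n) \<otimes> b [^] (n * n) = (a [^] m \<otimes> b [^] n) [^] n"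
    using ab by (simp add: int_pow_distrib int_pow_pow)
  ultimately have "a [^] (m * n) \<otimes> b = \<one>" unfolding rel by simp
  then have "b \<otimes> a [^] (m * n) = \<one>" using ab by (simp add: m_comm)
  then have b: "b = a [^] (- (m * n))" using ab by (simp add: int_pow_neg inv_equality[symmetric])
  have "card (carrier G) \<le> 3 * 1"
  proof (rule card_two_generated[of a \<one>])
    fix x assume "x \<in> carrier G"
    then obtain k l :: int where "x = a [^] k \<otimes> b [^] l" using gen by blast
    also have "\<dots> = a [^] (k + - (m * n) * l) \<otimes> \<one> [^] (0::int)"
      unfolding b using ab by (simp only: int_pow_mult int_pow_pow int_pow_0 r_one int_pow_closed m_closed)
    finally show "\<exists>(m::int) (n::int). x = a [^] m \<otimes> \<one> [^] n" by blast
  qed (use ab in simp_all)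
  then show False using big by simp
qed

lemma cubes_ratio:
  assumes "p \<in> carrier G" "q \<in> carrier G" "p \<otimes> p \<otimes> p = q \<otimes> q \<otimes> q"
  shows "(q \<otimes> inv p) [^] (3::int) = \<one>"
proof -
  have 3: "x [^] (3::int) = x \<otimes> x \<otimes> x" if "x \<in> carrier G" for x
    using that int_pow_mult[of x 1 1] int_pow_mult[of x 2 1] by simp
  have "(q \<otimes> inv p) [^] (3::int) = (q \<otimes> q \<otimes> q) \<otimes> (inv p \<otimes> inv p \<otimes> inv p)"
    using assms(1,2) by (simp add: 3) (simp only: m_ac m_closed inv_closed)
  also have "\<dots> = (p \<otimes> inv p) \<otimes> (p \<otimes> inv p) \<otimes> (p \<otimes> inv p)"
    unfolding assms(3)[symmetric] using assms(1) by (simp only: m_ac m_closed inv_closed)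
  finally show ?thesis using assms(1) by simp
qed

text \<open>By independence a relation between \<open>a\<close> and \<open>b\<close> has both
  exponents divisible by 3, so it also holds for \<open>a'\<close> and \<open>b'\<close>, whose
  cubes are trivial. Hence the assignment of \<open>a'\<close> to \<open>a\<close> and
  \<open>b'\<close> to \<open>b\<close> extends to a homomorphism, which is onto because
  \<open>a'\<close> and \<open>b'\<close> generate.\<close>

lemma affine_cubes:
  assumes fin: "finite (carrier G)" and big: "card (carrier G) > 3"
    and S: "{p, q, r} \<subseteq> carrier G" "adj_connected G {p, q, r}"
      "p \<otimes> p \<otimes> p = q \<otimes> q \<otimes> q" "p \<otimes> p \<otimes> p = r \<otimes> r \<otimes> r"
    and T: "{p', q', r'} \<subseteq> carrier G" "adj_connected G {p', q', r'}"
      "p' \<otimes> p' \<otimes> p' = q' \<otimes> q' \<otimes> q'" "p' \<otimes> p' \<otimes> p' = r' \<otimes> r' \<otimes> r'"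
  shows "affine_equiv G {p, q, r} {p', q', r'}"
proof -
  define a where "a = q \<otimes> inv p"
  define b where "b = r \<otimes> inv p"
  define a' where "a' = q' \<otimes> inv p'"
  define b' where "b' = r' \<otimes> inv p'"
  note defs = a_def b_def a'_def b'_def
  have c: "a \<in> carrier G" "b \<in> carrier G" "a' \<in> carrier G" "b' \<in> carrier G"
    unfolding defs using S(1) T(1) by simp_all
  have cubes: "a [^] (3::int) = \<one>" "b [^] (3::int) = \<one>" "a' [^] (3::int) = \<one>" "b' [^] (3::int) = \<one>"
    unfolding defs using cubes_ratio S(1,3,4) T(1,3,4) by simp_all
  have gen: "\<exists>(m::int) (n::int). x = a [^] m \<otimes> b [^] n" if "x \<in> carrier G" for x
    using generated_by_ratios[OF S(1,2) that] unfolding defs by metis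
  have gen_swap: "\<exists>(m::int) (n::int). x = b [^] m \<otimes> a [^] n" if "x \<in> carrier G" for x
    using gen[OF that] c by (metis m_comm int_pow_closed)
  have gen': "\<exists>(m::int) (n::int). x = a' [^] m \<otimes> b' [^] n" if "x \<in> carrier G" for x
    using generated_by_ratios[OF T(1,2) that] unfolding defs by metis
  have rel: "a' [^] m \<otimes> b' [^] n = \<one>" if "a [^] m \<otimes> b [^] n = \<one>" for m n :: int
  proof -
    have "3 dvd n" using exponent_3_independent[OF c(1,2) cubes(1,2) gen big that] .
    moreover have "b [^] n \<otimes> a [^] m = \<one>" using that c by (simp add: m_comm)
    then have "3 dvd m" using exponent_3_independent[OF c(2,1) cubes(2,1) gen_swap big] by blast
    ultimately show ?thesis
      using int_pow_mod[OF c(3) cubes(3), of m] int_pow_mod[OF c(4) cubes(4), of n] by simp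
  qed
  obtain \<phi> where \<phi>: "\<phi> \<in> hom G G" "\<phi> (a [^] m \<otimes> b [^] n) = a' [^] m \<otimes> b' [^] n" for m n :: int
    using hom_two_generated[OF c gen rel] by metis
  have "carrier G \<subseteq> \<phi> ` carrier G"
  proof
    fix x assume "x \<in> carrier G"
    then obtain m n :: int where "x = a' [^] m \<otimes> b' [^] n" using gen' by blast
    then show "x \<in> \<phi> ` carrier G"
      using \<phi>(2)[of m n] c by (intro image_eqI[of _ _ "a [^] m \<otimes> b [^] n"]) simp_all
  qed
  then show ?thesis
  proof (rule affine_ratioI[OF fin S(1) T(1) \<phi>(1)])
    show "\<phi> (q \<otimes> inv p) = q' \<otimes> inv p'" using \<phi>(2)[of 1 0] c unfolding defs by simp
    show "\<phi> (r \<otimes> inv p) = r' \<otimes> inv p'" using \<phi>(2)[of 0 1] c unfolding defs by simp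
  qed
qed

text \<open>Equal cubes in \<open>T\<close> give every quotient of labels, hence every group
  element, a trivial cube. Then p^3 = q^3 as well, and the relation cancels to q = r.\<close>

lemma cyclic_not_cubes:
  assumes "q \<in> carrier G" "r \<in> carrier G" "q \<noteq> r" "p \<in> carrier G" "p \<otimes> p \<otimes> p = q \<otimes> q \<otimes> r"
    and T: "T \<subseteq> carrier G" "adj_connected G T"
      "\<And>s t. s \<in> T \<Longrightarrow> t \<in> T \<Longrightarrow> s \<otimes> s \<otimes> s = t \<otimes> t \<otimes> t"
  shows False
proof -
  have "{x \<in> carrier G. x [^] (3::int) = \<one>} = carrier G" (is "?A = _")
  proof (rule closed_carrier[OF T(1,2)])
    fix x s t assume x: "x \<in> ?A" and st: "s \<in> T" "t \<in> T"
    have sc: "s \<in> carrier G" "t \<in> carrier G" using st T(1) by auto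
    have "(s \<otimes> inv t \<otimes> x) [^] (3::int) = (s \<otimes> inv t) [^] (3::int) \<otimes> x [^] (3::int)"
      using sc x by (simp only: int_pow_distrib m_closed inv_closed mem_Collect_eq)
    also have "\<dots> = \<one>" using cubes_ratio[OF sc(2,1) T(3)[OF st(2,1)]] x by simp
    finally show "s \<otimes> inv t \<otimes> x \<in> ?A" using sc x by simp
  qed auto
  then have "x [^] (3::int) = \<one>" if "x \<in> carrier G" for x using that by blast
  then have 3: "x \<otimes> x \<otimes> x = \<one>" if "x \<in> carrier G" for x
    using that int_pow_mult[of x 1 1] int_pow_mult[of x 2 1] by simp
  have "q \<otimes> q \<otimes> q = q \<otimes> q \<otimes> r" using 3[OF assms(4)] 3[OF assms(1)] assms(5) by simp
  then show False using assms(1-3) by simp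
qed

section \<open>Combination of the cases\<close>

lemma iso_affine:
  assumes fin: "finite (carrier G)"
    and S: "S \<subseteq> carrier G" "card S = 3" "arc_homogeneous G S" "adj_connected G S"
    and T: "T \<subseteq> carrier G" and f: "bicay_iso G T S f"
  shows "affine_equiv G S T"
proof -
  note g = bicay_iso_inv[OF f]
  have T: "T \<subseteq> carrier G" "card T = 3" "arc_homogeneous G T" "adj_connected G T"
    using T card_iso[OF T S(1) f] S(2) arc_homogeneous_iso[OF g S(3)] adj_connected_iso[OF g S(4)] by simp_all
  show ?thesis
  proof (cases "generic G S \<or> generic G T \<or> card (carrier G) \<le> 4")
    case True
    then consider "generic G S" | "generic G T" | "card (carrier G) \<le> 4" by blast
    then show ?thesis
    proof cases
      case 1
      \<comment> \<open>Genericity is required of the target: \<open>f\<close> leads to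
        \<open>S\<close>, so the resulting equivalence has to be reversed, while for generic
        \<open>T\<close> the inverse isomorphism \<open>g\<close> gives the right direction at
        once.\<close>
      then have "affine_equiv G T S" using generic_affine[OF fin S(1) _ S(2) T(1,2,4) f] by blast
      then show ?thesis using affine_sym[OF T(1) fin] by blast
    next
      case 2
      then show ?thesis using generic_affine[OF fin T(1) _ T(2) S(1,2,4) g] by blast
    next
      case 3
      then show ?thesis using affine_small[OF fin _ S(1) T(1) S(2) T(2)] by blast
    qed
  next
    case False
    then have ng: "\<not> generic G S" "\<not> generic G T" and big: "\<not> card (carrier G) \<le> 4" by blast+
    from S ng(1) show ?thesis
    proof (cases rule: not_generic_cases)
      case small then show ?thesis using big by blast
    next
      case (cyclic p q r)
      note s = this
      from T ng(2) show ?thesis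
      proof (cases rule: not_generic_cases)
        case small then show ?thesis using big by blast
      next
        case (cyclic p' q' r')
        then show ?thesis using affine_cyclic[OF fin, of p q r p' q' r'] s S T by simp
      next
        case cubes
        have "False"
          by (rule cyclic_not_cubes[of q r p, OF _ _ s(2) _ s(3) T(1,4) cubes]) (use S(1) s(1) in auto)
        then show ?thesis ..
      qed
    next
      case cubes
      note s = this
      from T ng(2) show ?thesis
      proof (cases rule: not_generic_cases)
        case small then show ?thesis using big by blast
      next
        case (cyclic p q r)
        have "False"
          by (rule cyclic_not_cubes[of q r p, OF _ _ cyclic(2) _ cyclic(3) S(1,4) s]) (use T(1) cyclic(1) in auto)
        then show ?thesis ..
      next
        case cubes
        obtain p q r where p: "S = {p, q, r}" using S(2) by (auto simp: card_3_iff)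
        obtain p' q' r' where p': "T = {p', q', r'}" using T(2) by (auto simp: card_3_iff)
        show ?thesis
          unfolding p p'
          by (rule affine_cubes[OF fin]) (use big S T s cubes p p' in auto)
      qed
    qed
  qed
qed

end

theorem theoremB:
  fixes H :: "('a, 'c) monoid_scheme" and S :: "'a set"
  assumes "comm_group H"
    and "finite (carrier H)"
    and "S \<subseteq> carrier H"
    and "cubic (with_proj (BiCay H S))"
    and "symmetric_graph (with_proj (BiCay H S))"
  shows "BCI_graph H S"
proof -
  interpret comm_group H by (rule assms(1))
  have S: "card S = 3" "arc_homogeneous H S" "adj_connected H S"
    using cubic_card assms(2-5) arc_transitive_arc_homogeneous connected_adj_connected
    unfolding symmetric_graph_def by blast+
  have "affine_equiv H S T"
    if T: "T \<subseteq> carrier H" "digraph_iso (with_proj (BiCay H T)) (with_proj (BiCay H S))" for T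
  proof -
    obtain f where "bicay_iso H T S f"
      using T(2) unfolding digraph_iso_BiCay_iff bicay_iso_def by blast
    then show ?thesis by (rule iso_affine[OF assms(2,3) S T(1)])
  qed
  then show ?thesis unfolding BCI_graph_def affine_equiv_def by blast
qed

end
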